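(* Let $X$ be a compact metric space and let $f:X\to X$ be a homeomorphism. (a) If $f$ is minimal and almost automorphic, but not equicontinuous, then $f$ has unbounded separation numbers. (b) If $f$ is an almost sure 1-1 extension of an equicontinuous system, then $f$ has finite separation numbers.
   Context: Separation numbers. Let $(X,d)$ be a metric space and $f:X\to X$. For $x,y\in X$, $\delta>0$, $n\in\mathbb{N}$ let $S_n(f,\delta,x,y)=\#\{0\le k<n \mid d(f^k(x),f^k(y))\ge\delta\}$. For $\nu\in(0,1]$, points $x,y$ are $(f,\delta,\nu)$-separated if $\limsup_{n\to\infty} S_n(f,\delta,x,y)/n\ge\nu$. A subset $S\subseteq X$ is $(f,\delta,\nu)$-separated if all pairs of distinct points of $S$ are $(f,\delta,\nu)$-separated. $\operatorname{Sep}(f,\delta,\nu)$ is the largest cardinality (possibly $\infty$) of an $(f,\delta,\nu)$-separated subset of $X$. The map $f$ has finite separation numbers if $\operatorname{Sep}(f,\delta,\nu)<\infty$ for all $\delta>0$ and $\nu\in(0,1]$. It has bounded separation numbers if for every $\delta>0$ the quantity $\operatorname{Sep}(f,\delta,\nu)$ is uniformly bounded in $\nu\in(0,1]$; otherwise its separation numbers are unbounded. Extensions. Let $f:X\to X$ and $g:\Xi\to\Xi$ be continuous maps of metric spaces. $f$ is an extension of $g$ (and $g$ a factor of $f$) if there is a continuous onto map $h:X\to\Xi$ with $h\circ f=g\circ h$. It is an almost 1-1 extension if $\{\xi\in\Xi\mid \#h^{-1}(\xi)=1\}$ is dense in $\Xi$. It is an almost sure 1-1 extension if $\{\xi\in\Xi\mid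 \#h^{-1}(\xi)>1\}$ has measure zero with respect to every $g$-invariant Borel probability measure on $\Xi$. A map $g$ is equicontinuous if the family of its iterates $\{g^n\}$ is equicontinuous. A minimal system is almost automorphic if it is an almost 1-1 extension of an equicontinuous minimal system. *)

theory Defs
  imports "HOL-Probability.Probability" "HOL-Library.Extended_Nat"
begin

text \<open>
  A metric space is a carrier set \<open>X\<close> in a type of class \<^class>\<open>metric_space\<close>, with the
  induced metric and subspace topology. A self-map of \<open>X\<close> is a function on the whole type
  whose values outside \<open>X\<close> are irrelevant.
\<close>

text \<open>\<^const>\<open>card\<close> is \<open>0\<close> on infinite sets, so cardinalities are taken in \<^typ>\<open>enat\<close>.\<close>

definition ecard :: "'a set \<Rightarrow> enat" where
  "ecard A = (if finite A then enat (card A) else \<infinity>)"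


subsection \<open>Separation numbers\<close>

definition sep_count ::
    "('a::metric_space \<Rightarrow> 'a) \<Rightarrow> real \<Rightarrow> 'a \<Rightarrow> 'a \<Rightarrow> nat \<Rightarrow> nat" where
  "sep_count f \<delta> x y n = card {k. k < n \<and> dist ((f ^^ k) x) ((f ^^ k) y) \<ge> \<delta>}"

definition separated_points ::
    "('a::metric_space \<Rightarrow> 'a) \<Rightarrow> real \<Rightarrow> real \<Rightarrow> 'a \<Rightarrow> 'a \<Rightarrow> bool" where
  "separated_points f \<delta> \<nu> x y \<longleftrightarrow>
     limsup (\<lambda>n. ereal (real (sep_count f \<delta> x y n) / real n)) \<ge> ereal \<nu>"

definition separated_set ::
    "('a::metric_space \<Rightarrow> 'a) \<Rightarrow> real \<Rightarrow> real \<Rightarrow> 'a set \<Rightarrow> bool" where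
  "separated_set f \<delta> \<nu> S \<longleftrightarrow>
     (\<forall>x\<in>S. \<forall>y\<in>S. x \<noteq> y \<longrightarrow> separated_points f \<delta> \<nu> x y)"

definition Sep :: "'a::metric_space set \<Rightarrow> ('a \<Rightarrow> 'a) \<Rightarrow> real \<Rightarrow> real \<Rightarrow> enat" where
  "Sep X f \<delta> \<nu> = (SUP S\<in>{S. S \<subseteq> X \<and> separated_set f \<delta> \<nu> S}. ecard S)"

definition finite_separation_numbers :: "'a::metric_space set \<Rightarrow> ('a \<Rightarrow> 'a) \<Rightarrow> bool" where
  "finite_separation_numbers X f \<longleftrightarrow> (\<forall>\<delta>>0. \<forall>\<nu>\<in>{0<..1}. Sep X f \<delta> \<nu> < \<infinity>)"

definition bounded_separation_numbers :: "'a::metric_space set \<Rightarrow> ('a \<Rightarrow> 'a) \<Rightarrow> bool" where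
  "bounded_separation_numbers X f \<longleftrightarrow>
     (\<forall>\<delta>>0. \<exists>K::nat. \<forall>\<nu>\<in>{0<..1}. Sep X f \<delta> \<nu> \<le> enat K)"

abbreviation unbounded_separation_numbers :: "'a::metric_space set \<Rightarrow> ('a \<Rightarrow> 'a) \<Rightarrow> bool" where
  "unbounded_separation_numbers X f \<equiv> \<not> bounded_separation_numbers X f"


subsection \<open>Systems and extensions\<close>

definition continuous_self_map :: "'a::metric_space set \<Rightarrow> ('a \<Rightarrow> 'a) \<Rightarrow> bool" where
  "continuous_self_map X f \<longleftrightarrow> continuous_on X f \<and> f \<in> X \<rightarrow> X"

definition factor_map ::
    "'a::metric_space set \<Rightarrow> ('a \<Rightarrow> 'a) \<Rightarrow> 'b::metric_space set \<Rightarrow> ('b \<Rightarrow> 'b) \<Rightarrow> ('a \<Rightarrow> 'b) \<Rightarrow> bool" where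
  "factor_map X f \<Xi> g h \<longleftrightarrow>
     continuous_self_map X f \<and> continuous_self_map \<Xi> g \<and>
     continuous_on X h \<and> h ` X = \<Xi> \<and> (\<forall>x\<in>X. h (f x) = g (h x))"

definition almost_1_1_extension ::
    "'a::metric_space set \<Rightarrow> ('a \<Rightarrow> 'a) \<Rightarrow> 'b::metric_space set \<Rightarrow> ('b \<Rightarrow> 'b) \<Rightarrow> bool" where
  "almost_1_1_extension X f \<Xi> g \<longleftrightarrow>
     (\<exists>h. factor_map X f \<Xi> g h \<and>
          \<Xi> \<subseteq> closure {\<xi>\<in>\<Xi>. ecard {x\<in>X. h x = \<xi>} = 1})"

definition invariant_prob_measure ::
    "'b::metric_space set \<Rightarrow> ('b \<Rightarrow> 'b) \<Rightarrow> 'b measure \<Rightarrow> bool" where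
  "invariant_prob_measure \<Xi> g \<mu> \<longleftrightarrow>
     prob_space \<mu> \<and> space \<mu> = \<Xi> \<and> sets \<mu> = sets (restrict_space borel \<Xi>) \<and> distr \<mu> \<mu> g = \<mu>"

text \<open>
  \<^const>\<open>emeasure\<close> is \<open>0\<close> on non-measurable sets, so measure zero is expressed by
  membership in \<^const>\<open>null_sets\<close>.
\<close>

definition almost_sure_1_1_extension ::
    "'a::metric_space set \<Rightarrow> ('a \<Rightarrow> 'a) \<Rightarrow> 'b::metric_space set \<Rightarrow> ('b \<Rightarrow> 'b) \<Rightarrow> bool" where
  "almost_sure_1_1_extension X f \<Xi> g \<longleftrightarrow>
     (\<exists>h. factor_map X f \<Xi> g h \<and>
          (\<forall>\<mu>. invariant_prob_measure \<Xi> g \<mu> \<longrightarrow>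
               {\<xi>\<in>\<Xi>. ecard {x\<in>X. h x = \<xi>} > 1} \<in> null_sets \<mu>))"

definition equicontinuous_system :: "'a::metric_space set \<Rightarrow> ('a \<Rightarrow> 'a) \<Rightarrow> bool" where
  "equicontinuous_system X f \<longleftrightarrow>
     continuous_self_map X f \<and>
     (\<forall>x\<in>X. \<forall>\<epsilon>>0. \<exists>\<delta>>0. \<forall>y\<in>X. dist x y < \<delta> \<longrightarrow>
        (\<forall>n. dist ((f ^^ n) x) ((f ^^ n) y) < \<epsilon>))"

text \<open>
  Density of all forward orbits; for a continuous self-map this says that there is no proper
  nonempty closed forward invariant subset, and for a homeomorphism of a compact space that
  all two-sided orbits are dense.
\<close>

definition minimal_system :: "'a::metric_space set \<Rightarrow> ('a \<Rightarrow> 'a) \<Rightarrow> bool" where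
  "minimal_system X f \<longleftrightarrow>
     continuous_self_map X f \<and> X \<noteq> {} \<and>
     (\<forall>x\<in>X. X \<subseteq> closure (range (\<lambda>n. (f ^^ n) x)))"

text \<open>
  HOL cannot quantify existentially over the type carrying the factor, so this type is a
  parameter. In hypothesis position a type variable for it ranges over all factors.
\<close>

definition almost_automorphic ::
    "'b::metric_space itself \<Rightarrow> 'a::metric_space set \<Rightarrow> ('a \<Rightarrow> 'a) \<Rightarrow> bool" where
  "almost_automorphic _ X f \<longleftrightarrow>
     minimal_system X f \<and>
     (\<exists>(\<Xi> :: 'b set) g. minimal_system \<Xi> g \<and> equicontinuous_system \<Xi> g \<and>
          almost_1_1_extension X f \<Xi> g)"

end

theory Submission
  imports Defs
begin

text \<open>
  (a) The factor map is not injective, so some fibre contains two points at distance more than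
  \<open>\<delta>\<close>. Hence the points \<open>z\<close> of the orbit of a point with a one-point fibre have arbitrarily close
  neighbours in the same orbit that are at some time more than \<open>\<delta>\<close> apart from \<open>z\<close>, and
  by induction there are arbitrarily large finite subsets of the orbit in which any two points
  are more than \<open>\<delta>\<close> apart at some time. Almost periods of the equicontinuous factor have positive
  density and lift to one-point fibres, so the pairs are apart with positive frequency.

  (b) In the factor \<open>\<Xi>\<close>, the set \<open>C\<close> of points whose fibre has diameter at least \<open>\<delta>\<close> is closed and null for all invariant
  measures, hence some neighbourhood \<open>U\<close> of \<open>C\<close> is visited with frequency less than \<open>\<nu>\<close>,
  uniformly (otherwise empirical measures would accumulate at an invariant measure charging \<open>C\<close>).
  Two orbits in \<open>\<Xi>\<close> that stay close enough lift to orbits at distance less than \<open>\<delta>\<close> outside the visits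
  to \<open>U\<close>. By equicontinuity and compactness finitely many classes of such orbits exhaust \<open>\<Xi>\<close>.
\<close>

subsection \<open>Iterates, fibres and equicontinuity\<close>

lemma continuous_self_map_funpow:
  assumes "continuous_self_map X f"
  shows "continuous_self_map X (f ^^ n)"
proof (induction n)
  case 0
  then show ?case by (simp add: continuous_self_map_def continuous_on_id)
next
  case (Suc n)
  then have "continuous_on X (f \<circ> (f ^^ n))"
    using assms unfolding continuous_self_map_def
    by (intro continuous_on_compose) (auto intro: continuous_on_subset)
  then show ?case
    using Suc assms by (auto simp: continuous_self_map_def)
qed

lemma funpow_in:
  assumes "continuous_self_map X f" "x \<in> X"
  shows "(f ^^ n) x \<in> X"
  using continuous_self_map_funpow[OF assms(1), of n] assms(2) by (auto simp: continuous_self_map_def)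

lemma continuous_on_funpow:
  "continuous_self_map X f \<Longrightarrow> continuous_on X (f ^^ n)"
  using continuous_self_map_funpow continuous_self_map_def by blast

lemma factor_map_funpow:
  assumes "factor_map X f \<Xi> g h" "x \<in> X"
  shows "h ((f ^^ n) x) = (g ^^ n) (h x)"
proof (induction n)
  case (Suc n)
  have "(f ^^ n) x \<in> X"
    using assms by (auto simp: factor_map_def intro: funpow_in)
  then show ?case
    using assms Suc by (simp add: factor_map_def)
qed simp

text \<open>With \<open>U = {}\<close> this is uniform continuity of the inverse of an injective \<open>h\<close>; with
  \<open>U = - {\<xi>}\<close> it says that the fibres are upper semicontinuous at a point \<open>\<xi>\<close> with one
  preimage.\<close>

lemma close_images_imp_close:
  fixes h :: "'a::metric_space \<Rightarrow> 'b::metric_space"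
  assumes X: "compact X" and h: "continuous_on X h" and U: "open U"
    and C: "\<And>x y. \<lbrakk>x \<in> X; y \<in> X; h x = h y; dist x y \<ge> \<delta>\<rbrakk> \<Longrightarrow> h x \<in> U"
  obtains \<eta> where "\<eta> > 0"
    "\<And>x y. \<lbrakk>x \<in> X; y \<in> X; h x \<notin> U; dist (h x) (h y) < \<eta>\<rbrakk> \<Longrightarrow> dist x y < \<delta>"
proof -
  define T where "T = {p \<in> X \<times> X. dist (fst p) (snd p) \<in> {\<delta>..} \<and> h (fst p) \<in> - U}"
  have hf: "continuous_on (X \<times> X) (\<lambda>p. h (fst p))" "continuous_on (X \<times> X) (\<lambda>p. h (snd p))"
    using h by (auto intro!: continuous_on_compose2[OF h] continuous_intros)
  have cd: "continuous_on (X \<times> X) (\<lambda>p. dist (fst p) (snd p))"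
    by (intro continuous_intros)
  have XX: "compact (X \<times> X)" using X by (rule compact_Times) (rule X)
  have "T = {p \<in> X \<times> X. dist (fst p) (snd p) \<in> {\<delta>..}} \<inter> {p \<in> X \<times> X. h (fst p) \<in> - U}"
    by (auto simp: T_def)
  moreover have "closed {p \<in> X \<times> X. dist (fst p) (snd p) \<in> {\<delta>..}}"
    using continuous_closed_preimage[OF cd, of "{\<delta>..}"] XX
    by (auto simp: vimage_def Int_def compact_imp_closed)
  moreover have "closed {p \<in> X \<times> X. h (fst p) \<in> - U}"
    using continuous_closed_preimage[OF hf(1), of "- U"] XX U
    by (auto simp: vimage_def Int_def compact_imp_closed)
  ultimately have "closed T" by auto
  moreover have "T \<subseteq> X \<times> X" by (auto simp: T_def)
  ultimately have T: "compact T"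
    using compact_Int_closed[OF XX, of T] by (simp add: inf.absorb2)
  show ?thesis
  proof (cases "T = {}")
    case True
    show ?thesis
    proof (rule that[of 1])
      fix x y assume "x \<in> X" "y \<in> X" "h x \<notin> U"
      then have "(x, y) \<notin> T \<Longrightarrow> dist x y < \<delta>" by (auto simp: T_def)
      then show "dist x y < \<delta>" using True by simp
    qed simp
  next
    case False
    have "continuous_on T (\<lambda>p. dist (h (fst p)) (h (snd p)))"
      by (intro continuous_on_subset[OF continuous_on_dist[OF hf]]) (auto simp: T_def)
    from continuous_attains_inf[OF T False this] obtain q where q: "q \<in> T"
      "\<And>p. p \<in> T \<Longrightarrow> dist (h (fst q)) (h (snd q)) \<le> dist (h (fst p)) (h (snd p))" by blast
    have "h (fst q) \<noteq> h (snd q)"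
      using q(1) C[of "fst q" "snd q"] by (auto simp: T_def)
    show ?thesis
    proof (rule that[of "dist (h (fst q)) (h (snd q))"])
      fix x y assume *: "x \<in> X" "y \<in> X" "h x \<notin> U"
        and "dist (h x) (h y) < dist (h (fst q)) (h (snd q))"
      then have "(x, y) \<notin> T" using q(2)[of "(x, y)"] by auto
      then show "dist x y < \<delta>" using * by (auto simp: T_def)
    qed (use \<open>h (fst q) \<noteq> h (snd q)\<close> in simp)
  qed
qed

section \<open>Uniform equicontinuity and almost periods\<close>

lemma equicontinuous_systemD:
  assumes eq: "equicontinuous_system \<Xi> g" and \<Xi>: "compact \<Xi>" and "\<epsilon> > 0"
  obtains \<delta> where "\<delta> > 0"
    "\<And>\<xi> \<zeta> n. \<lbrakk>\<xi> \<in> \<Xi>; \<zeta> \<in> \<Xi>; dist \<xi> \<zeta> < \<delta>\<rbrakk> \<Longrightarrow> dist ((g ^^ n) \<xi>) ((g ^^ n) \<zeta>) < \<epsilon>"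
proof -
  from eq \<open>\<epsilon> > 0\<close> have "\<forall>\<xi>\<in>\<Xi>. \<exists>r>0. \<forall>\<zeta>\<in>\<Xi>. dist \<xi> \<zeta> < r \<longrightarrow>
      (\<forall>n. dist ((g ^^ n) \<xi>) ((g ^^ n) \<zeta>) < \<epsilon>/2)"
    unfolding equicontinuous_system_def by (meson half_gt_zero)
  then obtain r where r: "\<And>\<xi>. \<xi> \<in> \<Xi> \<Longrightarrow> r \<xi> > 0"
    "\<And>\<xi> \<zeta> n. \<lbrakk>\<xi> \<in> \<Xi>; \<zeta> \<in> \<Xi>; dist \<xi> \<zeta> < r \<xi>\<rbrakk> \<Longrightarrow> dist ((g ^^ n) \<xi>) ((g ^^ n) \<zeta>) < \<epsilon>/2"
    by metis
  have cov: "\<Xi> \<subseteq> \<Union>((\<lambda>\<xi>. ball \<xi> (r \<xi>)) ` \<Xi>)"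
    using r(1) by force
  \<comment> \<open>\<delta> is a Lebesgue number of this cover: points closer than \<delta> lie in
    one ball, and comparing both orbits with that of its centre costs \<epsilon>/2 twice.\<close>
  obtain \<delta> where \<delta>: "0 < \<delta>"
    "\<And>\<xi>. \<xi> \<in> \<Xi> \<Longrightarrow> \<exists>G\<in>(\<lambda>\<xi>. ball \<xi> (r \<xi>)) ` \<Xi>. ball \<xi> \<delta> \<subseteq> G"
    by (rule Heine_Borel_lemma[OF \<Xi> cov]) auto
  show ?thesis
  proof (rule that[OF \<open>\<delta> > 0\<close>])
    fix \<xi> \<zeta> n assume *: "\<xi> \<in> \<Xi>" "\<zeta> \<in> \<Xi>" "dist \<xi> \<zeta> < \<delta>"
    obtain \<omega> where \<omega>: "\<omega> \<in> \<Xi>" "ball \<xi> \<delta> \<subseteq> ball \<omega> (r \<omega>)"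
      using \<delta>(2)[OF *(1)] by auto
    have "dist \<omega> \<xi> < r \<omega>" "dist \<omega> \<zeta> < r \<omega>"
      using \<omega>(2) * \<delta>(1) by (auto simp: subset_iff)
    then show "dist ((g ^^ n) \<xi>) ((g ^^ n) \<zeta>) < \<epsilon>"
      using r(2)[OF \<omega>(1) *(1), of n] r(2)[OF \<omega>(1) *(2), of n]
      by (metis dist_triangle_half_r)
  qed
qed

text \<open>Compactness turns uniform equicontinuity into a finite colouring, the form needed for
  pigeonhole arguments: \<open>c\<close> picks the centre of a ball of radius \<delta>/2 from a
  finite subcover, so points of one colour are closer than \<delta>.\<close>

lemma equicontinuous_system_finite_classes:
  fixes \<Xi> :: "'b::metric_space set"
  assumes eq: "equicontinuous_system \<Xi> g" and \<Xi>: "compact \<Xi>" and "\<epsilon> > 0"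
  obtains F :: "'b set" and c where "finite F" "c \<in> \<Xi> \<rightarrow> F"
    "\<And>\<xi> \<zeta> n. \<lbrakk>\<xi> \<in> \<Xi>; \<zeta> \<in> \<Xi>; c \<xi> = c \<zeta>\<rbrakk> \<Longrightarrow> dist ((g ^^ n) \<xi>) ((g ^^ n) \<zeta>) < \<epsilon>"
proof -
  obtain \<delta> where \<delta>: "\<delta> > 0"
    "\<And>\<xi> \<zeta> n. \<lbrakk>\<xi> \<in> \<Xi>; \<zeta> \<in> \<Xi>; dist \<xi> \<zeta> < \<delta>\<rbrakk> \<Longrightarrow> dist ((g ^^ n) \<xi>) ((g ^^ n) \<zeta>) < \<epsilon>"
    using equicontinuous_systemD[OF assms] by blast
  obtain F where F: "finite F" "F \<subseteq> \<Xi>" "\<Xi> \<subseteq> (\<Union>\<omega>\<in>F. ball \<omega> (\<delta>/2))"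
    using \<open>\<delta> > 0\<close> compactE_image[OF \<Xi>, of \<Xi> "\<lambda>\<omega>. ball \<omega> (\<delta>/2)"]
    by (metis UN_I centre_in_ball half_gt_zero open_ball subsetI)
  then have "\<forall>\<xi>\<in>\<Xi>. \<exists>\<omega>\<in>F. dist \<omega> \<xi> < \<delta>/2"
    unfolding subset_iff UN_iff mem_ball by blast
  then obtain c where c: "\<And>\<xi>. \<xi> \<in> \<Xi> \<Longrightarrow> c \<xi> \<in> F \<and> dist (c \<xi>) \<xi> < \<delta>/2" by metis
  show ?thesis
  proof (rule that[OF F(1), of c])
    fix \<xi> \<zeta> n assume *: "\<xi> \<in> \<Xi>" "\<zeta> \<in> \<Xi>" "c \<xi> = c \<zeta>"
    then have "dist (c \<xi>) \<xi> < \<delta>/2" "dist (c \<xi>) \<zeta> < \<delta>/2" using c by metis+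
    then show "dist ((g ^^ n) \<xi>) ((g ^^ n) \<zeta>) < \<epsilon>"
      by (intro \<delta>(2) *) (rule dist_triangle_half_r)
  qed (use c in auto)
qed

text \<open>Pigeonhole: among the points \<open>g\<^sup>j \<zeta>\<close> with \<open>j < n\<close>, a fraction \<open>1/M\<close> lies in the same
  class as some first \<open>g\<^sup>i \<zeta>\<close>. Along the dense orbit of \<open>g\<^sup>i \<zeta>\<close>, the map \<open>g\<close> iterated \<open>j - i\<close> times
  moves points by less than \<open>\<epsilon>\<close>.\<close>

lemma equicontinuous_minimal_almost_periods:
  fixes \<Xi> :: "'b::metric_space set"
  assumes eq: "equicontinuous_system \<Xi> g" and \<Xi>: "compact \<Xi>" and min: "minimal_system \<Xi> g"
    and "\<epsilon> > 0"
  obtains M where "M > 0"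
    "\<And>n. n \<le> M * card {m. m < n \<and> (\<forall>\<xi>\<in>\<Xi>. dist ((g ^^ m) \<xi>) \<xi> \<le> \<epsilon>)}"
proof -
  obtain F :: "'b set" and c where F: "finite F" "c \<in> \<Xi> \<rightarrow> F"
    "\<And>\<xi> \<zeta> n. \<lbrakk>\<xi> \<in> \<Xi>; \<zeta> \<in> \<Xi>; c \<xi> = c \<zeta>\<rbrakk> \<Longrightarrow> dist ((g ^^ n) \<xi>) ((g ^^ n) \<zeta>) < \<epsilon>"
    using equicontinuous_system_finite_classes[OF eq \<Xi> \<open>\<epsilon> > 0\<close>] by blast
  \<comment> \<open>The inequality is not strict because it reaches all of \<Xi> by density of an
    orbit, and strict bounds do not survive limits.\<close>
  define R where "R = {m. \<forall>\<xi>\<in>\<Xi>. dist ((g ^^ m) \<xi>) \<xi> \<le> \<epsilon>}"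
  have g: "continuous_self_map \<Xi> g" and dense: "\<And>\<xi>. \<xi> \<in> \<Xi> \<Longrightarrow> \<Xi> \<subseteq> closure (range (\<lambda>n. (g ^^ n) \<xi>))"
    and "\<Xi> \<noteq> {}"
    using min by (auto simp: minimal_system_def)
  then obtain \<zeta> where \<zeta>: "\<zeta> \<in> \<Xi>" by auto
  have "F \<noteq> {}" using F(2) \<zeta> by auto
  have R: "j - i \<in> R" if "i \<le> j" and ij: "c ((g ^^ i) \<zeta>) = c ((g ^^ j) \<zeta>)" for i j
  proof -
    have "dist ((g ^^ (j - i)) \<xi>) \<xi> \<le> \<epsilon>" if "\<xi> \<in> \<Xi>" for \<xi>
    proof (rule ccontr)
      assume "\<not> ?thesis"
      then have gt: "dist ((g ^^ (j - i)) \<xi>) \<xi> > \<epsilon>" by simp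
      have "((\<lambda>\<omega>. dist ((g ^^ (j - i)) \<omega>) \<omega>) \<longlongrightarrow> dist ((g ^^ (j - i)) \<xi>) \<xi>) (at \<xi> within \<Xi>)"
        using continuous_on_funpow[OF g, of "j - i"] \<open>\<xi> \<in> \<Xi>\<close>
        by (intro tendsto_intros) (auto simp: continuous_on_def)
      from order_tendstoD(1)[OF this gt] obtain r where r: "r > 0"
        "\<And>\<omega>. \<lbrakk>\<omega> \<in> \<Xi>; dist \<omega> \<xi> < r\<rbrakk> \<Longrightarrow> \<epsilon> < dist ((g ^^ (j - i)) \<omega>) \<omega>"
        using gt unfolding eventually_at by metis
      obtain n where n: "dist ((g ^^ n) ((g ^^ i) \<zeta>)) \<xi> < r"
        using dense[of "(g ^^ i) \<zeta>"] funpow_in[OF g \<zeta>] \<open>\<xi> \<in> \<Xi>\<close> \<open>r > 0\<close>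
        by (force simp: closure_approachable)
      have "(g ^^ (j - i)) ((g ^^ n) ((g ^^ i) \<zeta>)) = (g ^^ n) ((g ^^ j) \<zeta>)"
        using \<open>i \<le> j\<close> by (simp add: add.commute flip: funpow_add comp_apply[of "_ ^^ _" "_ ^^ _"])
      then have "\<epsilon> < dist ((g ^^ n) ((g ^^ j) \<zeta>)) ((g ^^ n) ((g ^^ i) \<zeta>))"
        using r(2)[OF _ n] by (simp add: funpow_in g \<zeta>)
      then show False
        using F(3)[of "(g ^^ j) \<zeta>" "(g ^^ i) \<zeta>" n] ij by (simp add: funpow_in g \<zeta>)
    qed
    then show ?thesis by (auto simp: R_def)
  qed
  have *: "n \<le> card F * card {m. m < n \<and> m \<in> R}" for n
  proof -
    define J where "J \<omega> = {j. j < n \<and> c ((g ^^ j) \<zeta>) = \<omega>}" for \<omega>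
    have "{..<n} = (\<Union>\<omega>\<in>F. J \<omega>)"
      using F(2) funpow_in[OF g \<zeta>] by (auto simp: J_def)
    then have "n \<le> (\<Sum>\<omega>\<in>F. card (J \<omega>))"
      using card_UN_le[OF F(1), of J] by (metis card_lessThan)
    also have "\<dots> \<le> (\<Sum>\<omega>\<in>F. card {m. m < n \<and> m \<in> R})"
    proof (rule sum_mono)
      fix \<omega>
      show "card (J \<omega>) \<le> card {m. m < n \<and> m \<in> R}"
      proof (cases "J \<omega> = {}")
        case False
        \<comment> \<open>Subtracting the least index of the class is injective on it and leads to
          times below \<open>n\<close>.\<close>
        define i where "i = (LEAST j. j \<in> J \<omega>)"
        have i: "i \<in> J \<omega>" "\<And>j. j \<in> J \<omega> \<Longrightarrow> i \<le> j"
          using False unfolding i_def by (auto intro: LeastI Least_le)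
        have "(\<lambda>j. j - i) ` J \<omega> \<subseteq> {m. m < n \<and> m \<in> R}"
          using i R[of i] by (fastforce simp: J_def)
        moreover have "inj_on (\<lambda>j. j - i) (J \<omega>)"
          using i(2) by (intro inj_onI) (metis le_add_diff_inverse)
        ultimately show ?thesis
          by (intro card_inj_on_le[of "\<lambda>j. j - i"]) auto
      qed simp
    qed
    finally show ?thesis by simp
  qed
  show ?thesis
    by (rule that[of "card F"]) (use F(1) \<open>F \<noteq> {}\<close> * in \<open>auto simp: R_def card_gt_0_iff\<close>)
qed

text \<open>Almost periods are unbounded, so \<open>g^n\<close> can be continued to some
  \<open>g^m\<close> with \<open>m \<ge> n\<close> that is nearly the identity, and the remaining
  \<open>m - n\<close> steps keep close images close. This is uniform equicontinuity of the inverse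
  iterates.\<close>

lemma equicontinuous_minimal_inverse:
  assumes eq: "equicontinuous_system \<Xi> g" and \<Xi>: "compact \<Xi>" and min: "minimal_system \<Xi> g"
    and "\<epsilon> > 0"
  obtains \<delta> where "\<delta> > 0"
    "\<And>\<xi> \<zeta> n. \<lbrakk>\<xi> \<in> \<Xi>; \<zeta> \<in> \<Xi>; dist ((g ^^ n) \<xi>) ((g ^^ n) \<zeta>) < \<delta>\<rbrakk> \<Longrightarrow> dist \<xi> \<zeta> < \<epsilon>"
proof -
  have "\<epsilon>/3 > 0" using \<open>\<epsilon> > 0\<close> by simp
  obtain \<delta> where \<delta>: "\<delta> > 0"
    "\<And>\<xi> \<zeta> n. \<lbrakk>\<xi> \<in> \<Xi>; \<zeta> \<in> \<Xi>; dist \<xi> \<zeta> < \<delta>\<rbrakk> \<Longrightarrow> dist ((g ^^ n) \<xi>) ((g ^^ n) \<zeta>) < \<epsilon>/3"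
    using equicontinuous_systemD[OF eq \<Xi> \<open>\<epsilon>/3 > 0\<close>] by blast
  obtain M where M: "M > 0"
    "\<And>n. n \<le> M * card {m. m < n \<and> (\<forall>\<xi>\<in>\<Xi>. dist ((g ^^ m) \<xi>) \<xi> \<le> \<epsilon>/3)}"
    using equicontinuous_minimal_almost_periods[OF eq \<Xi> min \<open>\<epsilon>/3 > 0\<close>] by blast
  have g: "continuous_self_map \<Xi> g" using min by (simp add: minimal_system_def)
  show ?thesis
  proof (rule that[OF \<open>\<delta> > 0\<close>])
    fix \<xi> \<zeta> n assume *: "\<xi> \<in> \<Xi>" "\<zeta> \<in> \<Xi>" "dist ((g ^^ n) \<xi>) ((g ^^ n) \<zeta>) < \<delta>"
    \<comment> \<open>There are more than \<open>n\<close> almost periods below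
      \<open>Suc (M * n)\<close>, so one of them is at least \<open>n\<close>.\<close>
    define R where "R = {m. m < Suc (M * n) \<and> (\<forall>\<xi>\<in>\<Xi>. dist ((g ^^ m) \<xi>) \<xi> \<le> \<epsilon>/3)}"
    have "\<not> R \<subseteq> {..<n}"
    proof
      assume "R \<subseteq> {..<n}"
      then have le: "card R \<le> n"
        using card_mono[OF finite_lessThan] by (metis card_lessThan)
      show False
        using M(2)[of "Suc (M * n)"] mult_le_mono2[OF le, of M] unfolding R_def by linarith
    qed
    then obtain m where m: "m \<ge> n" "\<forall>\<xi>\<in>\<Xi>. dist ((g ^^ m) \<xi>) \<xi> \<le> \<epsilon>/3"
      unfolding R_def by (auto simp: subset_iff not_less)
    have "dist ((g ^^ m) \<xi>) ((g ^^ m) \<zeta>) < \<epsilon>/3"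
      using \<delta>(2)[OF _ _ *(3), of "m - n"] m(1) *
      by (simp add: funpow_in g flip: funpow_add comp_apply[of "_ ^^ _" "_ ^^ _"])
    moreover have "dist ((g ^^ m) \<xi>) \<xi> \<le> \<epsilon>/3" "dist ((g ^^ m) \<zeta>) \<zeta> \<le> \<epsilon>/3"
      using m(2) * by auto
    ultimately show "dist \<xi> \<zeta> < \<epsilon>"
      using dist_triangle[of \<xi> \<zeta> "(g ^^ m) \<xi>"] dist_triangle[of "(g ^^ m) \<xi>" \<zeta> "(g ^^ m) \<zeta>"]
      by (simp add: dist_commute)
  qed
qed

subsection \<open>Almost automorphic systems\<close>

lemma close_to_single_fibre:
  fixes h :: "'a::metric_space \<Rightarrow> 'b::metric_space"
  assumes X: "compact X" and h: "continuous_on X h"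
    and single: "\<And>y. \<lbrakk>y \<in> X; h y = h x\<rbrakk> \<Longrightarrow> y = x" and "x \<in> X" "\<epsilon> > 0"
  obtains \<eta> where "\<eta> > 0" "\<And>y. \<lbrakk>y \<in> X; dist (h x) (h y) < \<eta>\<rbrakk> \<Longrightarrow> dist x y < \<epsilon>"
proof -
  have U: "open (- {h x})" by (simp add: open_Compl)
  have C: "h a \<in> - {h x}" if "a \<in> X" "b \<in> X" "h a = h b" "dist a b \<ge> \<epsilon>" for a b
    using single[of a] single[of b] that \<open>\<epsilon> > 0\<close> by auto
  obtain \<eta> where "\<eta> > 0"
    "\<And>a b. \<lbrakk>a \<in> X; b \<in> X; h a \<notin> - {h x}; dist (h a) (h b) < \<eta>\<rbrakk> \<Longrightarrow> dist a b < \<epsilon>"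
    by (rule close_images_imp_close[OF X h U, of \<epsilon>]) (use C in blast)+
  then show ?thesis using \<open>x \<in> X\<close> that by auto
qed

text \<open>A separation at one time recurs. At an almost period \<open>m\<close> of the factor,
  \<open>h (f^m x)\<close> is close to \<open>h x\<close>, hence \<open>f^m x\<close> is close to
  \<open>x\<close> because the fibre is a single point. The same \<open>m\<close> works for
  \<open>y\<close>, so both orbits are apart again at time \<open>k + m\<close>. The conclusion
  holds for all small \<nu>, which allows finitely many pairs to share one \<nu>.\<close>

lemma single_fibres_separated:
  fixes X :: "'a::metric_space set" and \<Xi> :: "'b::metric_space set"
  assumes X: "compact X" and fac: "factor_map X f \<Xi> g h"
    and min: "minimal_system \<Xi> g" and eq: "equicontinuous_system \<Xi> g"
    and x: "x \<in> X" "\<And>z. \<lbrakk>z \<in> X; h z = h x\<rbrakk> \<Longrightarrow> z = x"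
    and y: "y \<in> X" "\<And>z. \<lbrakk>z \<in> X; h z = h y\<rbrakk> \<Longrightarrow> z = y"
    and gt: "dist ((f ^^ k) x) ((f ^^ k) y) > \<delta>"
  shows "eventually (\<lambda>\<nu>. separated_points f \<delta> \<nu> x y) (at_right 0)"
proof -
  have f: "continuous_self_map X f" and h: "continuous_on X h" "h ` X = \<Xi>"
    using fac by (auto simp: factor_map_def)
  have \<Xi>: "compact \<Xi>" using compact_continuous_image[OF h(1) X] h(2) by simp
  define e where "e = (dist ((f ^^ k) x) ((f ^^ k) y) - \<delta>) / 2"
  have "e > 0" using gt by (simp add: e_def)
  have fk: "continuous_on X (f ^^ k)" using f by (rule continuous_on_funpow)
  from fk x(1) \<open>e > 0\<close> obtain dx where dx: "dx > 0"
      "\<And>z. \<lbrakk>z \<in> X; dist z x < dx\<rbrakk> \<Longrightarrow> dist ((f ^^ k) z) ((f ^^ k) x) < e"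
    unfolding continuous_on_iff by blast
  from fk y(1) \<open>e > 0\<close> obtain dy where dy: "dy > 0"
      "\<And>z. \<lbrakk>z \<in> X; dist z y < dy\<rbrakk> \<Longrightarrow> dist ((f ^^ k) z) ((f ^^ k) y) < e"
    unfolding continuous_on_iff by blast
  obtain \<eta>x where \<eta>x: "\<eta>x > 0" "\<And>z. \<lbrakk>z \<in> X; dist (h x) (h z) < \<eta>x\<rbrakk> \<Longrightarrow> dist x z < dx"
    by (rule close_to_single_fibre[OF X h(1) _ x(1) dx(1)]) (use x(2) in blast)+
  obtain \<eta>y where \<eta>y: "\<eta>y > 0" "\<And>z. \<lbrakk>z \<in> X; dist (h y) (h z) < \<eta>y\<rbrakk> \<Longrightarrow> dist y z < dy"
    by (rule close_to_single_fibre[OF X h(1) _ y(1) dy(1)]) (use y(2) in blast)+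
  \<comment> \<open>Halved because almost periods only give distance at most \<eta>, while the
    fibres need strict bounds.\<close>
  define \<eta> where "\<eta> = min \<eta>x \<eta>y / 2"
  have \<eta>: "\<eta> > 0" "\<eta> < \<eta>x" "\<eta> < \<eta>y" using \<eta>x(1) \<eta>y(1) by (auto simp: \<eta>_def min_def)
  define R where "R = {m. \<forall>\<xi>\<in>\<Xi>. dist ((g ^^ m) \<xi>) \<xi> \<le> \<eta>}"
  obtain M where M: "M > 0" "\<And>n. n \<le> M * card {m. m < n \<and> m \<in> R}"
    using equicontinuous_minimal_almost_periods[OF eq \<Xi> min \<eta>(1)] unfolding R_def by auto
  have R: "dist ((f ^^ (k + m)) x) ((f ^^ (k + m)) y) \<ge> \<delta>" if "m \<in> R" for m
  proof -
    have mX: "(f ^^ m) x \<in> X" "(f ^^ m) y \<in> X" using f x y by (auto intro: funpow_in)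
    have "h x \<in> \<Xi>" "h y \<in> \<Xi>" using x y h(2) by auto
    then have "dist (h x) (h ((f ^^ m) x)) < \<eta>x" "dist (h y) (h ((f ^^ m) y)) < \<eta>y"
      using that \<eta> x(1) y(1) by (force simp: R_def factor_map_funpow[OF fac] dist_commute)+
    then have "dist ((f ^^ k) ((f ^^ m) x)) ((f ^^ k) x) < e"
      "dist ((f ^^ k) ((f ^^ m) y)) ((f ^^ k) y) < e"
      using \<eta>x(2) \<eta>y(2) dx(2) dy(2) mX by (metis dist_commute)+
    then have "dist ((f ^^ k) ((f ^^ m) x)) ((f ^^ k) ((f ^^ m) y)) \<ge> \<delta>"
      using dist_triangle[of "(f ^^ k) x" "(f ^^ k) y" "(f ^^ k) ((f ^^ m) x)"]
        dist_triangle[of "(f ^^ k) ((f ^^ m) x)" "(f ^^ k) y" "(f ^^ k) ((f ^^ m) y)"]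
      by (simp add: e_def dist_commute field_simps)
    then show ?thesis by (simp add: funpow_add)
  qed
  have count: "n - k \<le> M * sep_count f \<delta> x y n" for n
  proof -
    have "(+) k ` {m. m < n - k \<and> m \<in> R} \<subseteq> {i. i < n \<and> dist ((f ^^ i) x) ((f ^^ i) y) \<ge> \<delta>}"
      using R by auto
    then have "card {m. m < n - k \<and> m \<in> R} \<le> sep_count f \<delta> x y n"
      unfolding sep_count_def by (intro card_inj_on_le[of "(+) k"]) auto
    then show ?thesis using M(2)[of "n - k"] by (meson le_trans mult_le_mono2)
  qed
  have sep: "separated_points f \<delta> \<nu> x y" if "\<nu> \<le> 1 / (2 * real M)" for \<nu>
    unfolding separated_points_def
  proof (rule le_Limsup)
    \<comment> \<open>For \<open>n > 2 * k\<close>, the \<open>k\<close> times lost by the shift are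
      less than half of \<open>n\<close>; this is the factor 2 in the bound on \<nu>.\<close>
    show "\<forall>\<^sub>F n in sequentially. ereal \<nu> \<le> ereal (real (sep_count f \<delta> x y n) / real n)"
      using eventually_ge_at_top[of "2 * k + 1"]
    proof eventually_elim
      case (elim n)
      have "n \<le> 2 * (M * sep_count f \<delta> x y n)" using count[of n] elim by linarith
      then have "real n \<le> 2 * real M * real (sep_count f \<delta> x y n)"
        by (metis of_nat_le_iff of_nat_mult of_nat_numeral mult.assoc)
      then have "1 / (2 * real M) \<le> real (sep_count f \<delta> x y n) / real n"
        using elim M(1) by (simp add: field_simps)
      then show ?case using that by simp
    qed
  qed simp
  have "1 / (2 * real M) > 0" using M(1) by simp
  then show ?thesis
    by (intro eventually_at_rightI[of 0 "1 / (2 * real M)"]) (auto intro: sep)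
qed

text \<open>The points \<open>f\<^sup>b x\<close> arise as \<open>f\<^sup>-\<^sup>k\<close> of a point of the orbit of \<open>x\<close> that lies close to
  \<open>x\<^sub>2\<close>, where \<open>k\<close> is such that \<open>f\<^sup>k(f\<^sup>a x)\<close> lies close to \<open>x\<^sub>1\<close>. Both images under \<open>h\<close> are close at
  time \<open>k\<close>, hence also at time \<open>0\<close>.\<close>

lemma sensitive_along_orbit:
  fixes X :: "'a::metric_space set" and \<Xi> :: "'b::metric_space set"
  assumes X: "compact X" and minf: "minimal_system X f" and fac: "factor_map X f \<Xi> g h"
    and min: "minimal_system \<Xi> g" and eq: "equicontinuous_system \<Xi> g"
    and x: "x \<in> X" "\<And>z. \<lbrakk>z \<in> X; h z = h ((f ^^ a) x)\<rbrakk> \<Longrightarrow> z = (f ^^ a) x"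
    and x12: "x1 \<in> X" "x2 \<in> X" "h x1 = h x2" "dist x1 x2 > \<delta>" and "r > 0"
  obtains b k where "dist ((f ^^ a) x) ((f ^^ b) x) < r"
    "dist ((f ^^ k) ((f ^^ a) x)) ((f ^^ k) ((f ^^ b) x)) > \<delta>"
proof -
  have f: "continuous_self_map X f" and h: "continuous_on X h" "h ` X = \<Xi>"
    using fac by (auto simp: factor_map_def)
  have \<Xi>: "compact \<Xi>" using compact_continuous_image[OF h(1) X] h(2) by simp
  have orb: "(f ^^ n) x \<in> X" "h ((f ^^ n) x) \<in> \<Xi>" for n
    using funpow_in[OF f x(1)] h(2) by auto
  have visit: "\<exists>m. dist ((f ^^ m) ((f ^^ n) x)) z < s" if "z \<in> X" "s > 0" for z s n
    using minf orb(1)[of n] that by (fastforce simp: minimal_system_def closure_approachable)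
  obtain \<eta> where \<eta>: "\<eta> > 0" "\<And>y. \<lbrakk>y \<in> X; dist (h ((f ^^ a) x)) (h y) < \<eta>\<rbrakk> \<Longrightarrow> dist ((f ^^ a) x) y < r"
    by (rule close_to_single_fibre[OF X h(1) _ orb(1)[of a] \<open>r > 0\<close>]) (use x(2) in blast)+
  obtain \<theta> where \<theta>: "\<theta> > 0"
    "\<And>\<xi> \<zeta> n. \<lbrakk>\<xi> \<in> \<Xi>; \<zeta> \<in> \<Xi>; dist ((g ^^ n) \<xi>) ((g ^^ n) \<zeta>) < \<theta>\<rbrakk> \<Longrightarrow> dist \<xi> \<zeta> < \<eta>"
    using equicontinuous_minimal_inverse[OF eq \<Xi> min \<eta>(1)] by blast
  \<comment> \<open>Half of the excess over \<delta>, so that two approximations with error below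
    \<open>e\<close> leave a distance above \<delta>.\<close>
  define e where "e = (dist x1 x2 - \<delta>) / 2"
  have "e > 0" using x12(4) by (simp add: e_def)
  have near: "\<exists>s>0. s \<le> e \<and> (\<forall>y\<in>X. dist y z < s \<longrightarrow> dist (h y) (h z) < \<theta>/2)" if zX: "z \<in> X" for z
  proof -
    obtain s where "s > 0" "\<And>y. \<lbrakk>y \<in> X; dist y z < s\<rbrakk> \<Longrightarrow> dist (h y) (h z) < \<theta>/2"
      using h(1) zX half_gt_zero[OF \<theta>(1)] unfolding continuous_on_iff by blast
    then show ?thesis using \<open>e > 0\<close> by (intro exI[of _ "min s e"]) auto
  qed
  obtain s1 where s1: "s1 > 0" "s1 \<le> e" "\<And>y. \<lbrakk>y \<in> X; dist y x1 < s1\<rbrakk> \<Longrightarrow> dist (h y) (h x1) < \<theta>/2"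
    using near[OF x12(1)] by blast
  obtain s2 where s2: "s2 > 0" "s2 \<le> e" "\<And>y. \<lbrakk>y \<in> X; dist y x2 < s2\<rbrakk> \<Longrightarrow> dist (h y) (h x2) < \<theta>/2"
    using near[OF x12(2)] by blast
  obtain k where k: "dist ((f ^^ k) ((f ^^ a) x)) x1 < s1"
    using visit[OF x12(1) s1(1)] by blast
  \<comment> \<open>The visit to \<open>x2\<close> is counted from \<open>f^k x\<close>, so it
    occurs at a time \<open>k + b\<close>; commuting the iterates makes it the \<open>k\<close>-th
    image of \<open>f^b x\<close>.\<close>
  obtain b where b: "dist ((f ^^ b) ((f ^^ k) x)) x2 < s2"
    using visit[OF x12(2) s2(1)] by blast
  have b': "dist ((f ^^ k) ((f ^^ b) x)) x2 < s2"
    using b by (simp add: add.commute flip: funpow_add comp_apply[of "_ ^^ _" "_ ^^ _"])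
  have in_X: "(f ^^ k) ((f ^^ n) x) \<in> X" for n using f orb(1) by (rule funpow_in)
  have "dist (h ((f ^^ k) ((f ^^ a) x))) (h x1) < \<theta>/2" "dist (h ((f ^^ k) ((f ^^ b) x))) (h x1) < \<theta>/2"
    using s1(3)[OF in_X k] s2(3)[OF in_X b'] x12(3) by auto
  then have "dist (h ((f ^^ k) ((f ^^ a) x))) (h ((f ^^ k) ((f ^^ b) x))) < \<theta>"
    by (metis dist_triangle_half_l)
  then have "dist (h ((f ^^ a) x)) (h ((f ^^ b) x)) < \<eta>"
    using \<theta>(2) orb by (simp add: factor_map_funpow[OF fac])
  then have 1: "dist ((f ^^ a) x) ((f ^^ b) x) < r"
    using \<eta>(2) orb by simp
  have "dist ((f ^^ k) ((f ^^ a) x)) ((f ^^ k) ((f ^^ b) x)) > \<delta>"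
    using k b' s1(2) s2(2) dist_triangle[of x1 x2 "(f ^^ k) ((f ^^ a) x)"]
      dist_triangle[of "(f ^^ k) ((f ^^ a) x)" x2 "(f ^^ k) ((f ^^ b) x)"]
    by (simp add: e_def dist_commute field_simps)
  then show ?thesis using 1 that by blast
qed

text \<open>A new point is placed next to an old one: being apart from another point of
  \<open>S\<close> at a fixed time is an open condition on \<open>x\<close>, so a point of
  \<open>Q\<close> near \<open>x\<close> that separates from \<open>x\<close> also separates from
  the rest of \<open>S\<close>.\<close>

lemma arbitrarily_many_separating_points:
  fixes X :: "'a::metric_space set"
  assumes f: "continuous_self_map X f" and "Q \<subseteq> X" "Q \<noteq> {}"
    and sens: "\<And>x r. \<lbrakk>x \<in> Q; r > 0\<rbrakk> \<Longrightarrow> \<exists>y\<in>Q. dist x y < r \<and> (\<exists>k. dist ((f ^^ k) x) ((f ^^ k) y) > \<delta>)"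
    and "\<delta> \<ge> 0"
  shows "\<exists>S\<subseteq>Q. finite S \<and> card S = Suc n \<and>
           (\<forall>x\<in>S. \<forall>y\<in>S. x \<noteq> y \<longrightarrow> (\<exists>k. dist ((f ^^ k) x) ((f ^^ k) y) > \<delta>))"
proof (induction n)
  case 0
  obtain x where "x \<in> Q" using \<open>Q \<noteq> {}\<close> by auto
  then show ?case by (intro exI[of _ "{x}"]) auto
next
  case (Suc n)
  define P where "P x y \<longleftrightarrow> (\<exists>k. dist ((f ^^ k) x) ((f ^^ k) y) > \<delta>)" for x y
  have P_sym: "P x y \<longleftrightarrow> P y x" for x y by (simp add: P_def dist_commute)
  from Suc obtain S where S: "S \<subseteq> Q" "finite S" "card S = Suc n"
    "\<And>x y. \<lbrakk>x \<in> S; y \<in> S; x \<noteq> y\<rbrakk> \<Longrightarrow> P x y"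
    unfolding P_def by blast
  then obtain x where x: "x \<in> S" by fastforce
  have "\<forall>\<^sub>F z in at x within X. P z y" if y: "y \<in> S - {x}" for y
  proof -
    obtain k where k: "dist ((f ^^ k) x) ((f ^^ k) y) > \<delta>"
      using S(4)[of x y] x y by (auto simp: P_def)
    have "((\<lambda>z. dist ((f ^^ k) z) ((f ^^ k) y)) \<longlongrightarrow> dist ((f ^^ k) x) ((f ^^ k) y)) (at x within X)"
      using continuous_on_funpow[OF f, of k] x S(1) \<open>Q \<subseteq> X\<close>
      by (intro tendsto_intros) (auto simp: continuous_on_def)
    from order_tendstoD(1)[OF this k] show ?thesis
      by (rule eventually_mono) (auto simp: P_def)
  qed
  then have "\<forall>\<^sub>F z in at x within X. \<forall>y\<in>S - {x}. P z y"
    using S(2) by (simp add: eventually_ball_finite_distrib)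
  then obtain r where r: "r > 0" "\<And>z y. \<lbrakk>z \<in> X; z \<noteq> x; dist z x < r; y \<in> S - {x}\<rbrakk> \<Longrightarrow> P z y"
    unfolding eventually_at by blast
  obtain z where z: "z \<in> Q" "dist x z < r" "P x z"
    using sens[of x r] x S(1) r(1) unfolding P_def by blast
  \<comment> \<open>As no point separates from itself, \<open>z\<close> is outside \<open>S\<close>
    and the cardinality grows.\<close>
  have irrefl: "\<not> P y y" for y using \<open>\<delta> \<ge> 0\<close> by (simp add: P_def)
  have "z \<noteq> x" using z(3) irrefl by auto
  then have Pz: "P z y" if "y \<in> S" for y
    using r(2)[of z y] z that \<open>Q \<subseteq> X\<close> P_sym[of x z] by (cases "y = x") (auto simp: dist_commute)
  then have "z \<notin> S" using irrefl by blast
  then have "card (insert z S) = Suc (Suc n)" using S by simp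
  moreover have "P u v" if "u \<in> insert z S" "v \<in> insert z S" "u \<noteq> v" for u v
    using that S(4) Pz P_sym by blast
  ultimately show ?case
    using S(1,2) z(1) unfolding P_def by (intro exI[of _ "insert z S"]) auto
qed

text \<open>The inverse of a continuous injection on a compact space is uniformly continuous and
  carries closeness of orbits in \<Xi> back to \<open>X\<close>. The contrapositive supplies the
  fibre with two points from which (a) starts.\<close>

lemma injective_extension_equicontinuous:
  assumes X: "compact X" and fac: "factor_map X f \<Xi> g h" and eq: "equicontinuous_system \<Xi> g"
    and inj: "inj_on h X"
  shows "equicontinuous_system X f"
  unfolding equicontinuous_system_def
proof (intro conjI ballI allI impI)
  show "continuous_self_map X f" using fac by (simp add: factor_map_def)
  then have fX: "(f ^^ n) y \<in> X" if "y \<in> X" for n y using that by (rule funpow_in)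
  fix x and \<epsilon> :: real assume "x \<in> X" "\<epsilon> > 0"
  have h: "continuous_on X h" "h ` X = \<Xi>" using fac by (auto simp: factor_map_def)
  have C: "h a \<in> {}" if "a \<in> X" "b \<in> X" "h a = h b" "dist a b \<ge> \<epsilon>" for a b
    using inj_onD[OF inj that(3,1,2)] that(4) \<open>\<epsilon> > 0\<close> by simp
  obtain \<eta> where \<eta>: "\<eta> > 0" "\<And>a b. \<lbrakk>a \<in> X; b \<in> X; dist (h a) (h b) < \<eta>\<rbrakk> \<Longrightarrow> dist a b < \<epsilon>"
    by (rule close_images_imp_close[OF X h(1) open_empty, of \<epsilon>]) (use C in blast)+
  have "h x \<in> \<Xi>" using \<open>x \<in> X\<close> h(2) by auto
  then obtain s where s: "s > 0"
    "\<And>\<zeta> n. \<lbrakk>\<zeta> \<in> \<Xi>; dist (h x) \<zeta> < s\<rbrakk> \<Longrightarrow> dist ((g ^^ n) (h x)) ((g ^^ n) \<zeta>) < \<eta>"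
    using eq \<eta>(1) unfolding equicontinuous_system_def by metis
  obtain d where d: "d > 0" "\<And>y. \<lbrakk>y \<in> X; dist y x < d\<rbrakk> \<Longrightarrow> dist (h y) (h x) < s"
    using h(1) \<open>x \<in> X\<close> s(1) unfolding continuous_on_iff by blast
  have "dist ((f ^^ n) x) ((f ^^ n) y) < \<epsilon>" if "y \<in> X" "dist x y < d" for y n
  proof (rule \<eta>(2))
    show "dist (h ((f ^^ n) x)) (h ((f ^^ n) y)) < \<eta>"
      using s(2)[of "h y" n] d(2)[of y] that h(2) \<open>x \<in> X\<close>
      by (auto simp: factor_map_funpow[OF fac] dist_commute)
  qed (use fX that \<open>x \<in> X\<close> in auto)
  then show "\<exists>\<delta>>0. \<forall>y\<in>X. dist x y < \<delta> \<longrightarrow> (\<forall>n. dist ((f ^^ n) x) ((f ^^ n) y) < \<epsilon>)"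
    using d(1) by blast
qed

text \<open>A point over \<open>h (f^(n+1) x)\<close> has an \<open>f\<close>-preimage by
  surjectivity, and injectivity of \<open>g\<close> puts this preimage into the fibre of
  \<open>f^n x\<close>, to which the induction hypothesis applies.\<close>

lemma single_fibre_funpow:
  assumes fac: "factor_map X f \<Xi> g h" and surj: "f ` X = X" and inj: "inj_on g \<Xi>"
    and x: "x \<in> X" "\<And>z. \<lbrakk>z \<in> X; h z = h x\<rbrakk> \<Longrightarrow> z = x"
    and z: "z \<in> X" "h z = h ((f ^^ n) x)"
  shows "z = (f ^^ n) x"
  using z
proof (induction n arbitrary: z)
  case (Suc n)
  have f: "continuous_self_map X f" and h: "h ` X = \<Xi>"
    using fac by (auto simp: factor_map_def)
  obtain y where y: "y \<in> X" "z = f y" using surj Suc.prems(1) by blast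
  have "(f ^^ n) x \<in> X" using f x(1) by (rule funpow_in)
  moreover from this have "g (h y) = g (h ((f ^^ n) x))"
    using Suc.prems(2) y fac by (simp add: factor_map_def)
  ultimately have "h y = h ((f ^^ n) x)"
    using inj y(1) h by (auto dest: inj_onD)
  then show ?case using Suc.IH[OF y(1)] y(2) by simp
qed (use x in simp)

section \<open>Unbounded separation numbers of almost automorphic systems\<close>

lemma ecard_eq_1: "ecard A = 1 \<longleftrightarrow> (\<exists>x. A = {x})"
  by (auto simp: ecard_def one_enat_def card_1_singleton_iff)

lemma almost_automorphic_unbounded:
  fixes X :: "'a::metric_space set"
  assumes X: "compact X" and surj: "f ` X = X" and aut: "almost_automorphic TYPE('b::metric_space) X f"
    and neq: "\<not> equicontinuous_system X f"
  shows "unbounded_separation_numbers X f"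
proof -
  from aut obtain \<Xi> :: "'b set" and g where minf: "minimal_system X f"
    and min: "minimal_system \<Xi> g" and eq: "equicontinuous_system \<Xi> g"
    and ext: "almost_1_1_extension X f \<Xi> g"
    unfolding almost_automorphic_def by auto
  from ext obtain h where fac: "factor_map X f \<Xi> g h"
    and dense: "\<Xi> \<subseteq> closure {\<xi>\<in>\<Xi>. ecard {x\<in>X. h x = \<xi>} = 1}"
    unfolding almost_1_1_extension_def by auto
  have f: "continuous_self_map X f" and h: "continuous_on X h" "h ` X = \<Xi>"
    using fac by (auto simp: factor_map_def)
  have \<Xi>: "compact \<Xi>" using compact_continuous_image[OF h(1) X] h(2) by simp
  have "\<Xi> \<noteq> {}" using min by (simp add: minimal_system_def)
  then obtain \<xi> where "ecard {x\<in>X. h x = \<xi>} = 1"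
    using dense by (metis (mono_tags, lifting) closure_empty empty_Collect_eq subset_empty)
  then obtain x where "{x\<in>X. h x = \<xi>} = {x}" by (auto simp: ecard_eq_1)
  then have "z \<in> X \<and> h z = \<xi> \<longleftrightarrow> z = x" for z by (simp add: set_eq_iff)
  then have x: "x \<in> X" "\<And>z. \<lbrakk>z \<in> X; h z = h x\<rbrakk> \<Longrightarrow> z = x" by metis+
  \<comment> \<open>If \<open>g \<xi> = g \<zeta>\<close>, the first iterates have distance 0, and
    equicontinuity of the inverse iterates with tolerance \<open>dist \<xi> \<zeta>\<close> puts
    this distance below itself.\<close>
  have inj: "inj_on g \<Xi>"
  proof (rule inj_onI, rule ccontr)
    fix \<xi> \<zeta> assume *: "\<xi> \<in> \<Xi>" "\<zeta> \<in> \<Xi>" "g \<xi> = g \<zeta>" "\<xi> \<noteq> \<zeta>"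
    then have "dist \<xi> \<zeta> > 0" by simp
    from equicontinuous_minimal_inverse[OF eq \<Xi> min this] obtain \<delta> where \<delta>: "\<delta> > 0"
      "\<And>\<alpha> \<beta> n. \<lbrakk>\<alpha> \<in> \<Xi>; \<beta> \<in> \<Xi>; dist ((g ^^ n) \<alpha>) ((g ^^ n) \<beta>) < \<delta>\<rbrakk> \<Longrightarrow> dist \<alpha> \<beta> < dist \<xi> \<zeta>"
      by blast
    from \<delta>(1) \<delta>(2)[OF *(1,2), of 1] show False using *(3) by simp
  qed
  have single: "z = (f ^^ n) x" if "z \<in> X" "h z = h ((f ^^ n) x)" for z n
    using single_fibre_funpow[OF fac surj inj x that] .
  obtain x1 x2 where x12: "x1 \<in> X" "x2 \<in> X" "h x1 = h x2" "x1 \<noteq> x2"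
    using injective_extension_equicontinuous[OF X fac eq] neq by (auto simp: inj_on_def)
  \<comment> \<open>\<delta> is fixed before the number \<open>K\<close> of points; only \<nu> is
    adapted to \<open>K\<close>.\<close>
  define \<delta> where "\<delta> = dist x1 x2 / 2"
  have \<delta>: "\<delta> > 0" "dist x1 x2 > \<delta>" using x12(4) by (auto simp: \<delta>_def)
  define Orb where "Orb = range (\<lambda>n. (f ^^ n) x)"
  have Orb: "Orb \<subseteq> X" "Orb \<noteq> {}" using f x(1) by (auto simp: Orb_def intro: funpow_in)
  have sens: "\<exists>z\<in>Orb. dist y z < r \<and> (\<exists>k. dist ((f ^^ k) y) ((f ^^ k) z) > \<delta>)"
    if yr: "y \<in> Orb" "r > 0" for y r
  proof -
    obtain a where a: "y = (f ^^ a) x" using yr(1) by (auto simp: Orb_def)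
    obtain b k where "dist ((f ^^ a) x) ((f ^^ b) x) < r"
        "dist ((f ^^ k) ((f ^^ a) x)) ((f ^^ k) ((f ^^ b) x)) > \<delta>"
      by (rule sensitive_along_orbit[OF X minf fac min eq x(1) _ x12(1-3) \<delta>(2) yr(2)])
        (use single[of _ a] in blast)+
    then show ?thesis unfolding Orb_def a by blast
  qed
  have large: "\<exists>\<nu>\<in>{0<..1}. Sep X f \<delta> \<nu> \<ge> enat (Suc K)" for K
  proof -
    obtain S where S: "S \<subseteq> Orb" "finite S" "card S = Suc K"
      "\<And>y z. \<lbrakk>y \<in> S; z \<in> S; y \<noteq> z\<rbrakk> \<Longrightarrow> \<exists>k. dist ((f ^^ k) y) ((f ^^ k) z) > \<delta>"
      using arbitrarily_many_separating_points[OF f Orb sens, of K] \<delta>(1)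
      by (metis less_imp_le)
    have "\<forall>\<^sub>F \<nu> in at_right 0. y \<noteq> z \<longrightarrow> separated_points f \<delta> \<nu> y z"
      if yz: "y \<in> S" "z \<in> S" for y z
    proof (cases "y = z")
      case False
      then obtain k where k: "dist ((f ^^ k) y) ((f ^^ k) z) > \<delta>" using S(4) yz by blast
      obtain a b where ab: "y = (f ^^ a) x" "z = (f ^^ b) x" using S(1) yz unfolding Orb_def by blast
      have "y \<in> X" "z \<in> X" using yz S(1) Orb(1) by auto
      then have "\<forall>\<^sub>F \<nu> in at_right 0. separated_points f \<delta> \<nu> y z"
        by (intro single_fibres_separated[OF X fac min eq _ _ _ _ k]) (auto simp: ab intro: single)
      then show ?thesis by (rule eventually_mono) simp
    qed simp
    \<comment> \<open>There are finitely many pairs, so all of them are separated for a common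
      \<nu>.\<close>
    then have "\<forall>\<^sub>F \<nu> in at_right 0. \<forall>y\<in>S. \<forall>z\<in>S. y \<noteq> z \<longrightarrow> separated_points f \<delta> \<nu> y z"
      using S(2) by (simp add: eventually_ball_finite_distrib)
    moreover have "\<forall>\<^sub>F \<nu> in at_right 0. \<nu> \<in> {0<..1::real}"
      by (intro eventually_at_rightI[of 0 1]) auto
    ultimately have "\<forall>\<^sub>F \<nu> in at_right 0. \<nu> \<in> {0<..1} \<and> separated_set f \<delta> \<nu> S"
      by eventually_elim (auto simp: separated_set_def)
    then obtain \<nu> where \<nu>: "\<nu> \<in> {0<..1}" "separated_set f \<delta> \<nu> S"
      using eventually_happens'[OF trivial_limit_at_right_real] by blast
    have "ecard S \<le> Sep X f \<delta> \<nu>"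
      unfolding Sep_def using S(1) Orb(1) \<nu>(2) by (intro SUP_upper) auto
    then show ?thesis using \<nu>(1) S(2,3) by (auto simp: ecard_def)
  qed
  show ?thesis
  proof
    assume "bounded_separation_numbers X f"
    then obtain K where K: "\<forall>\<nu>\<in>{0<..1}. Sep X f \<delta> \<nu> \<le> enat K"
      using \<delta>(1) unfolding bounded_separation_numbers_def by blast
    with large[of K] show False by (meson Suc_n_not_le_n enat_ord_simps(1) order_trans)
  qed
qed

subsection \<open>Limits of empirical measures on compact metric spaces\<close>

text \<open>The balls of radius \<open>1 / (m + 1)\<close> from finite covers, for all
  \<open>m\<close>, are enumerated in one sequence. As \<open>K\<close> does not depend on the
  point, finitely many membership digits determine a point up to \<epsilon>.\<close>

lemma compact_refining_sets:
  fixes \<Xi> :: "'b::metric_space set"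
  assumes \<Xi>: "compact \<Xi>"
  obtains U :: "nat \<Rightarrow> 'b set" where
    "\<And>\<epsilon>. \<epsilon> > 0 \<Longrightarrow> \<exists>K. \<forall>\<xi>\<in>\<Xi>. \<exists>k<K. \<xi> \<in> U k \<and> (\<forall>\<zeta>\<in>U k. dist \<xi> \<zeta> < \<epsilon>)"
proof -
  have "\<exists>F. finite F \<and> \<Xi> \<subseteq> (\<Union>\<omega>\<in>F. ball \<omega> (1 / real (Suc m)))" for m
    using compactE_image[OF \<Xi>, of \<Xi> "\<lambda>\<omega>. ball \<omega> (1 / real (Suc m))"]
    by (metis UN_I centre_in_ball of_nat_0_less_iff open_ball subsetI zero_less_Suc zero_less_divide_1_iff)
  then obtain F where F: "\<And>m. finite (F m)" "\<And>m. \<Xi> \<subseteq> (\<Union>\<omega>\<in>F m. ball \<omega> (1 / real (Suc m)))"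
    by metis
  define B where "B = insert {} (\<Union>m. (\<lambda>\<omega>. ball \<omega> (1 / real (Suc m))) ` F m)"
  have B: "countable B" "B \<noteq> {}" using F(1) by (auto simp: B_def intro: countable_finite)
  define U where "U = from_nat_into B"
  have U: "\<exists>k. U k = V" if "V \<in> B" for V
    using from_nat_into_surj[OF B(1) that] by (auto simp: U_def)
  show ?thesis
  proof (rule that[of U])
    fix \<epsilon> :: real assume "\<epsilon> > 0"
    then obtain m where m: "1 / real (Suc m) < \<epsilon>/2"
      using nat_approx_posE[of "\<epsilon>/2"] by auto
    have "\<exists>k. U k = ball \<omega> (1 / real (Suc m))" if "\<omega> \<in> F m" for \<omega>
      using that by (intro U) (auto simp: B_def)
    then obtain i where i: "\<And>\<omega>. \<omega> \<in> F m \<Longrightarrow> U (i \<omega>) = ball \<omega> (1 / real (Suc m))" by metis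
    show "\<exists>K. \<forall>\<xi>\<in>\<Xi>. \<exists>k<K. \<xi> \<in> U k \<and> (\<forall>\<zeta>\<in>U k. dist \<xi> \<zeta> < \<epsilon>)"
    proof (rule exI[of _ "Suc (Max (i ` F m))"], rule ballI)
      fix \<xi> assume "\<xi> \<in> \<Xi>"
      then obtain \<omega> where \<omega>: "\<omega> \<in> F m" "dist \<omega> \<xi> < 1 / real (Suc m)"
        using F(2)[of m] unfolding subset_iff UN_iff mem_ball by blast
      have "dist \<xi> \<zeta> < \<epsilon>" if "dist \<omega> \<zeta> < 1 / real (Suc m)" for \<zeta>
        using that \<omega>(2) m by (meson dist_triangle_half_r less_trans)
      then have "\<xi> \<in> U (i \<omega>) \<and> (\<forall>\<zeta>\<in>U (i \<omega>). dist \<xi> \<zeta> < \<epsilon>)"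
        using \<omega> by (auto simp: i)
      moreover have "i \<omega> < Suc (Max (i ` F m))"
        using \<omega>(1) F(1) by (simp add: less_Suc_eq_le)
      ultimately show "\<exists>k<Suc (Max (i ` F m)). \<xi> \<in> U k \<and> (\<forall>\<zeta>\<in>U k. dist \<xi> \<zeta> < \<epsilon>)" by blast
    qed
  qed
qed

section \<open>Ternary coding of a compact space by real numbers\<close>

lemma summable_ternary: "summable (\<lambda>k. of_bool (P k) * (1/3) ^ k :: real)"
  by (rule summable_comparison_test[OF _ summable_geometric[of "1/3::real"]]) (auto intro!: exI[of _ 0])

text \<open>At the first differing digit \<open>j\<close> the sums gain a difference of
  \<open>(1/3)^j\<close>, and all later digits together can cancel at most half of it. In base 2
  they could cancel everything.\<close>

lemma ternary_differ:
  assumes "P k \<noteq> Q k" "k < K"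
  shows "\<bar>(\<Sum>k. of_bool (P k) * (1/3) ^ k) - (\<Sum>k. of_bool (Q k) * (1/3) ^ k :: real)\<bar> \<ge> (1/3) ^ K / 2"
proof -
  define j where "j = (LEAST k. P k \<noteq> Q k)"
  have j: "P j \<noteq> Q j" "j \<le> k"
    using LeastI[of "\<lambda>k. P k \<noteq> Q k", OF assms(1)] Least_le[of "\<lambda>k. P k \<noteq> Q k", OF assms(1)]
    unfolding j_def by blast+
  have eq: "P i = Q i" if "i < j" for i using that not_less_Least unfolding j_def by blast
  define d :: "nat \<Rightarrow> real" where "d i = (of_bool (P i) - of_bool (Q i)) * (1/3) ^ i" for i
  have sd: "summable d"
    unfolding d_def left_diff_distrib by (intro summable_diff summable_ternary)
  have geo: "summable (\<lambda>i. (1/3::real) ^ (Suc j + i))"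
    unfolding power_add by (intro summable_mult summable_geometric) simp
  have tail: "\<bar>\<Sum>i. d (i + Suc j)\<bar> \<le> (\<Sum>i. (1/3) ^ (Suc j + i))"
  proof (rule order_trans[OF summable_rabs])
    have le: "\<bar>d (i + Suc j)\<bar> \<le> (1/3) ^ (Suc j + i)" for i
      by (auto simp: d_def abs_mult add_ac power_add)
    show sum: "summable (\<lambda>i. \<bar>d (i + Suc j)\<bar>)"
      by (rule summable_comparison_test[OF _ geo]) (use le in auto)
    show "(\<Sum>i. \<bar>d (i + Suc j)\<bar>) \<le> (\<Sum>i. (1/3) ^ (Suc j + i))"
      by (rule suminf_le[OF le sum geo])
  qed
  also have "\<dots> = (1/3) ^ Suc j * (3/2)"
    unfolding power_add by (subst suminf_mult) (auto simp: suminf_geometric)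
  also have "\<dots> = (1/3) ^ j / 2" by simp
  finally have tail: "\<bar>\<Sum>i. d (i + Suc j)\<bar> \<le> (1/3) ^ j / 2" .
  have "(\<Sum>k. of_bool (P k) * (1/3) ^ k) - (\<Sum>k. of_bool (Q k) * (1/3) ^ k) = suminf d"
    unfolding d_def left_diff_distrib by (intro suminf_diff summable_ternary)
  also have "\<dots> = (\<Sum>i. d (i + Suc j)) + (\<Sum>i<Suc j. d i)"
    using suminf_split_initial_segment[OF sd] .
  also have "(\<Sum>i<Suc j. d i) = d j"
    using eq by (simp add: d_def)
  also have "\<bar>(\<Sum>i. d (i + Suc j)) + d j\<bar> \<ge> \<bar>d j\<bar> - \<bar>\<Sum>i. d (i + Suc j)\<bar>" by linarith
  moreover have "\<bar>d j\<bar> = (1/3) ^ j" using j(1) by (cases "P j"; cases "Q j") (auto simp: d_def)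
  moreover have "(1/3::real) ^ K \<le> (1/3) ^ j" using j(2) assms(2) by (intro power_decreasing) auto
  ultimately show ?thesis using tail by linarith
qed

text \<open>The inverse of the coding \<open>c\<close> is uniformly continuous on \<open>c ` \<Xi>\<close>. The closure of the graph of
  \<open>c\<close> is therefore the graph of a function on the closure of \<open>c ` \<Xi>\<close>, although \<open>c\<close> itself is
  not continuous.\<close>

lemma compact_eq_image_of_compact_real:
  fixes \<Xi> :: "'b::metric_space set"
  assumes \<Xi>: "compact \<Xi>"
  obtains K :: "real set" and \<pi> where "compact K" "continuous_on K \<pi>" "\<pi> ` K = \<Xi>"
proof -
  obtain U :: "nat \<Rightarrow> 'b set" where
    U: "\<And>\<epsilon>. \<epsilon> > 0 \<Longrightarrow> \<exists>K. \<forall>\<xi>\<in>\<Xi>. \<exists>k<K. \<xi> \<in> U k \<and> (\<forall>\<zeta>\<in>U k. dist \<xi> \<zeta> < \<epsilon>)"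
    using compact_refining_sets[OF \<Xi>] by blast
  define c :: "'b \<Rightarrow> real" where "c \<xi> = (\<Sum>k. of_bool (\<xi> \<in> U k) * (1/3) ^ k)" for \<xi>
  \<comment> \<open>If two codes differ by less than half of \<open>(1/3)^K\<close>, their first
    \<open>K\<close> digits agree, so \<zeta> lies in the small set \<open>U k\<close> found for
    \<xi>.\<close>
  have c_inv: "\<exists>\<delta>>0. \<forall>\<xi>\<in>\<Xi>. \<forall>\<zeta>\<in>\<Xi>. \<bar>c \<xi> - c \<zeta>\<bar> < \<delta> \<longrightarrow> dist \<xi> \<zeta> < \<epsilon>" if "\<epsilon> > 0" for \<epsilon>
  proof -
    obtain K where K: "\<forall>\<xi>\<in>\<Xi>. \<exists>k<K. \<xi> \<in> U k \<and> (\<forall>\<zeta>\<in>U k. dist \<xi> \<zeta> < \<epsilon>)" using U \<open>\<epsilon> > 0\<close> by blast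
    show ?thesis
    proof (intro exI[of _ "(1/3) ^ K / 2"] conjI ballI impI)
      fix \<xi> \<zeta> assume *: "\<xi> \<in> \<Xi>" "\<zeta> \<in> \<Xi>" "\<bar>c \<xi> - c \<zeta>\<bar> < (1/3) ^ K / 2"
      obtain k where k: "k < K" "\<xi> \<in> U k" "\<forall>\<zeta>\<in>U k. dist \<xi> \<zeta> < \<epsilon>" using K *(1) by blast
      have "\<zeta> \<in> U k"
        using ternary_differ[of "\<lambda>k. \<xi> \<in> U k" k "\<lambda>k. \<zeta> \<in> U k" K] *(3) k(1,2) unfolding c_def by linarith
      then show "dist \<xi> \<zeta> < \<epsilon>" using k(3) by blast
    qed simp
  qed
  have c_bound: "c \<xi> \<in> {0..3/2}" for \<xi>
  proof -
    have "c \<xi> \<le> (\<Sum>k. (1/3) ^ k)"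
      unfolding c_def by (intro suminf_le summable_ternary) auto
    moreover have "c \<xi> \<ge> 0" unfolding c_def by (intro suminf_nonneg summable_ternary) auto
    ultimately show ?thesis by (simp add: suminf_geometric)
  qed
  define G where "G = closure ((\<lambda>\<xi>. (c \<xi>, \<xi>)) ` \<Xi>)"
  have "(\<lambda>\<xi>. (c \<xi>, \<xi>)) ` \<Xi> \<subseteq> {0..3/2} \<times> \<Xi>" using c_bound by auto
  moreover have comp: "compact ({0..3/2::real} \<times> \<Xi>)" by (intro compact_Times \<Xi>) auto
  ultimately have G_sub: "G \<subseteq> {0..3/2} \<times> \<Xi>"
    unfolding G_def by (intro closure_minimal compact_imp_closed)
  then have G: "compact G"
    using compact_Int_closed[OF comp, of G] by (simp add: G_def inf.absorb2)
  have inj: "snd p = snd q" if pq: "p \<in> G" "q \<in> G" "fst p = fst q" for p q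
  proof (rule ccontr)
    assume "snd p \<noteq> snd q"
    then have pos: "dist (snd p) (snd q) / 3 > 0" by simp
    \<comment> \<open>A third of the distance, because three errors are added: two approximations
      and the distance of points with close codes.\<close>
    define \<epsilon> where "\<epsilon> = dist (snd p) (snd q) / 3"
    obtain \<delta> where \<delta>: "\<delta> > 0" "\<And>\<xi> \<zeta>. \<lbrakk>\<xi> \<in> \<Xi>; \<zeta> \<in> \<Xi>; \<bar>c \<xi> - c \<zeta>\<bar> < \<delta>\<rbrakk> \<Longrightarrow> dist \<xi> \<zeta> < \<epsilon>"
      using c_inv[OF pos] unfolding \<epsilon>_def by blast
    define r where "r = min \<epsilon> (\<delta>/2)"
    have r: "r > 0" using pos \<delta>(1) by (simp add: r_def \<epsilon>_def)
    obtain \<xi> where \<xi>: "\<xi> \<in> \<Xi>" "dist (c \<xi>, \<xi>) p < r"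
      using pq(1) r unfolding G_def closure_approachable by blast
    obtain \<zeta> where \<zeta>: "\<zeta> \<in> \<Xi>" "dist (c \<zeta>, \<zeta>) q < r"
      using pq(2) r unfolding G_def closure_approachable by blast
    have 1: "\<bar>c \<xi> - fst p\<bar> < r" "\<bar>c \<zeta> - fst q\<bar> < r"
      using le_less_trans[OF dist_fst_le \<xi>(2)] le_less_trans[OF dist_fst_le \<zeta>(2)]
      by (simp_all add: dist_real_def)
    have 2: "dist \<xi> (snd p) < r" "dist \<zeta> (snd q) < r"
      using le_less_trans[OF dist_snd_le \<xi>(2)] le_less_trans[OF dist_snd_le \<zeta>(2)] by simp_all
    have r': "r \<le> \<delta>/2" "r \<le> \<epsilon>" by (auto simp: r_def)
    have "\<bar>c \<xi> - c \<zeta>\<bar> < \<delta>" using 1 \<open>fst p = fst q\<close> r'(1) by linarith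
    then have 3: "dist \<xi> \<zeta> < \<epsilon>" using \<delta>(2) \<xi>(1) \<zeta>(1) by blast
    have "dist (snd p) (snd q) \<le> dist \<xi> (snd p) + dist \<xi> \<zeta> + dist \<zeta> (snd q)"
      using dist_triangle[of "snd p" "snd q" \<xi>] dist_triangle[of \<xi> "snd q" \<zeta>]
      by (simp add: dist_commute)
    then show False using 2 3 r'(2) unfolding \<epsilon>_def by linarith
  qed
  then have inj_fst: "inj_on fst G" by (intro inj_onI prod_eqI)
  define \<pi> where "\<pi> = snd \<circ> inv_into G fst"
  have "continuous_on (fst ` G) (inv_into G fst)"
    using inj_fst by (intro continuous_on_inv[OF continuous_on_fst[OF continuous_on_id] G]) simp
  then have "continuous_on (fst ` G) \<pi>"
    unfolding \<pi>_def by (intro continuous_on_compose continuous_on_snd continuous_on_id)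
  moreover have "compact (fst ` G)" by (intro compact_continuous_image G continuous_on_fst continuous_on_id)
  moreover have "\<pi> ` fst ` G = \<Xi>"
  proof -
    have "\<pi> ` fst ` G = snd ` G"
      unfolding \<pi>_def image_image comp_def using inj_fst by (intro image_cong) simp_all
    also have "\<dots> = \<Xi>"
    proof
      show "snd ` G \<subseteq> \<Xi>" using G_sub by auto
      have "(c \<xi>, \<xi>) \<in> G" if "\<xi> \<in> \<Xi>" for \<xi> using that closure_subset unfolding G_def by fast
      then show "\<Xi> \<subseteq> snd ` G" by force
    qed
    finally show ?thesis .
  qed
  ultimately show ?thesis using that by blast
qed

text \<open>Weak sequential compactness is imported from the real line: the measures are lifted
  along a section \<open>c\<close> of \<pi>, a subsequence converges there by tightness, and the
  limit is pushed forward by \<pi>. The section need not be continuous, since only finite averages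
  are lifted.\<close>

lemma compact_empirical_measures_converge:
  fixes \<Xi> :: "'b::metric_space set" and x :: "nat \<Rightarrow> nat \<Rightarrow> 'b" and N :: "nat \<Rightarrow> nat"
  assumes \<Xi>: "compact \<Xi>" and x: "\<And>n k. x n k \<in> \<Xi>" and N: "\<And>n. N n > 0"
  obtains r \<mu> where "strict_mono (r :: nat \<Rightarrow> nat)" "prob_space \<mu>" "space \<mu> = \<Xi>"
    "sets \<mu> = sets (restrict_space borel \<Xi>)"
    "\<And>\<phi> :: 'b \<Rightarrow> real. continuous_on \<Xi> \<phi> \<Longrightarrow>
       (\<lambda>i. (\<Sum>k<N (r i). \<phi> (x (r i) k)) / N (r i)) \<longlonglongrightarrow> integral\<^sup>L \<mu> \<phi>"
proof -
  obtain K :: "real set" and \<pi> where K: "compact K" "continuous_on K \<pi>" "\<pi> ` K = \<Xi>"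
    using compact_eq_image_of_compact_real[OF \<Xi>] by blast
  have "closed K" using K(1) by (rule compact_imp_closed)
  define c where "c = inv_into K \<pi>"
  have c: "c \<xi> \<in> K" "\<pi> (c \<xi>) = \<xi>" if "\<xi> \<in> \<Xi>" for \<xi>
    using that K(3) unfolding c_def by (auto intro: inv_into_into f_inv_into_f)
  define \<nu> where "\<nu> n = distr (measure_pmf (pmf_of_set {..<N n})) borel (\<lambda>k. c (x n k))" for n
  have \<nu>: "real_distribution (\<nu> n)" for n
    unfolding \<nu>_def by (intro prob_space.real_distribution_distr measure_pmf.prob_space_axioms) simp
  have \<nu>_int: "integral\<^sup>L (\<nu> n) \<psi> = (\<Sum>k<N n. \<psi> (c (x n k))) / N n" if "\<psi> \<in> borel_measurable borel" for \<psi> :: "real \<Rightarrow> real" and n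
    unfolding \<nu>_def using that N[of n]
    by (subst integral_distr) (auto simp: integral_pmf_of_set lessThan_empty_iff)
  have "tight \<nu>"
    unfolding tight_def
  proof (intro conjI allI impI \<nu>)
    fix \<epsilon> :: real assume "\<epsilon> > 0"
    obtain B where B: "\<And>t. t \<in> K \<Longrightarrow> \<bar>t\<bar> \<le> B" "B > 0"
      using compact_imp_bounded[OF K(1)] by (auto simp: bounded_pos)
    \<comment> \<open>The interval is open on the left, so it starts below \<open>- B\<close> to
      contain all of \<open>K\<close>.\<close>
    have "measure (\<nu> n) {- B - 1<..B} = 1" for n
    proof -
      have "c (x n k) \<in> {- B - 1<..B}" for k
        using B(1)[OF c(1)[OF x], of n k] by auto
      then have "(\<lambda>k. c (x n k)) -` {- B - 1<..B} = UNIV" by blast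
      then show ?thesis by (simp add: \<nu>_def measure_distr)
    qed
    then show "\<exists>a b. a < b \<and> (\<forall>n. 1 - \<epsilon> < measure (\<nu> n) {a<..b})"
      using \<open>\<epsilon> > 0\<close> B(2) by (intro exI[of _ "- B - 1"] exI[of _ B]) auto
  qed
  from tight_imp_convergent_subsubsequence[OF this strict_mono_id] obtain r M where
    r: "strict_mono r" and M: "real_distribution M" and "weak_conv_m (\<nu> \<circ> id \<circ> r) M" by blast
  then have conv: "weak_conv_m (\<lambda>i. \<nu> (r i)) M" by (simp add: comp_def)
  interpret M: real_distribution M by (rule M)
  have lim: "(\<lambda>i. (\<Sum>k<N (r i). \<psi> (c (x (r i) k))) / N (r i)) \<longlonglongrightarrow> integral\<^sup>L M \<psi>"
    if "continuous_on UNIV \<psi>" "\<And>t. norm (\<psi> t) \<le> B" for \<psi> :: "real \<Rightarrow> real" and B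
  proof -
    have "\<psi> \<in> borel_measurable borel" using that(1) by (rule borel_measurable_continuous_onI)
    moreover have "isCont \<psi> t" for t using that(1) by (simp add: continuous_on_eq_continuous_at)
    ultimately show ?thesis
      using weak_conv_imp_integral_bdd_continuous_conv[OF \<nu> M conv, of \<psi> B] that(2) by (simp add: \<nu>_int)
  qed
  have "\<Xi> \<noteq> {}" using x by auto
  then obtain \<omega> where \<omega>: "\<omega> \<in> \<Xi>" by auto
  have "K \<noteq> {}" using K(3) \<open>\<Xi> \<noteq> {}\<close> by auto
  \<comment> \<open>This bounded continuous test function vanishes exactly on \<open>K\<close>; its
    integral under the limit is 0, so the limit is carried by \<open>K\<close>.\<close>
  define \<psi>0 where "\<psi>0 t = min 1 (infdist t K)" for t
  have \<psi>0: "continuous_on UNIV \<psi>0" "norm (\<psi>0 t) \<le> 1" "0 \<le> \<psi>0 t" for t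
    unfolding \<psi>0_def by (auto intro!: continuous_intros simp: infdist_nonneg)
  have \<psi>0_meas: "\<psi>0 \<in> borel_measurable M"
    using borel_measurable_continuous_onI[OF \<psi>0(1)] by simp
  have int0: "integrable M \<psi>0"
    using \<psi>0(2) by (intro M.integrable_const_bound[of _ 1] \<psi>0_meas) auto
  have "\<psi>0 (c (x n k)) = 0" for n k
    using c(1)[OF x] by (simp add: \<psi>0_def)
  then have "integral\<^sup>L M \<psi>0 = 0"
    using lim[OF \<psi>0(1,2)] by (simp add: LIMSEQ_const_iff)
  then have "AE t in M. \<psi>0 t = 0"
    using integral_nonneg_eq_0_iff_AE[OF int0] \<psi>0(3) by simp
  then have AE_K: "AE t in M. t \<in> K"
  proof eventually_elim
    case (elim t)
    then have "infdist t K = 0" by (auto simp: \<psi>0_def min_def split: if_splits)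
    then show ?case using in_closed_iff_infdist_zero[OF \<open>closed K\<close> \<open>K \<noteq> {}\<close>] by simp
  qed
  define \<pi>' where "\<pi>' t = (if t \<in> K then \<pi> t else \<omega>)" for t
  have "\<pi>' \<in> borel_measurable borel"
    unfolding \<pi>'_def using K(2) \<open>closed K\<close> by (intro borel_measurable_continuous_on_if) auto
  moreover have "\<pi>' \<in> UNIV \<rightarrow> \<Xi>" using K(3) \<omega> by (auto simp: \<pi>'_def)
  ultimately have \<pi>': "\<pi>' \<in> M \<rightarrow>\<^sub>M restrict_space borel \<Xi>"
    by (intro measurable_restrict_space2) auto
  define \<mu> where "\<mu> = distr M (restrict_space borel \<Xi>) \<pi>'"
  show ?thesis
  proof (rule that[of r \<mu>])
    show "prob_space \<mu>" unfolding \<mu>_def by (rule M.prob_space_distr[OF \<pi>'])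
    show "space \<mu> = \<Xi>" "sets \<mu> = sets (restrict_space borel \<Xi>)"
      by (simp_all add: \<mu>_def space_restrict_space)
    fix \<phi> :: "'b \<Rightarrow> real" assume \<phi>: "continuous_on \<Xi> \<phi>"
    obtain B where B: "B > 0" "\<And>\<xi>. \<xi> \<in> \<Xi> \<Longrightarrow> norm (\<phi> \<xi>) \<le> B"
      using compact_imp_bounded[OF compact_continuous_image[OF \<phi> \<Xi>]] by (auto simp: bounded_pos)
    \<comment> \<open>Weak convergence tests against bounded continuous functions on the whole line,
      so \<open>\<phi> \<circ> \<pi>\<close> is extended from \<open>K\<close> with the same
      bound.\<close>
    obtain \<psi> where \<psi>: "continuous_on UNIV \<psi>" "\<And>t. t \<in> K \<Longrightarrow> \<psi> t = \<phi> (\<pi> t)" "\<And>t. norm (\<psi> t) \<le> B"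
    proof (rule Tietze[of K "\<phi> \<circ> \<pi>" UNIV B])
      show "continuous_on K (\<phi> \<circ> \<pi>)"
        using K \<phi> by (intro continuous_on_compose) auto
    qed (use \<open>closed K\<close> B K(3) in auto)
    have "integral\<^sup>L \<mu> \<phi> = (\<integral>t. \<phi> (\<pi>' t) \<partial>M)"
      unfolding \<mu>_def by (intro integral_distr \<pi>' borel_measurable_continuous_on_restrict \<phi>)
    also have "\<dots> = integral\<^sup>L M \<psi>"
    proof (rule integral_cong_AE)
      show "(\<lambda>t. \<phi> (\<pi>' t)) \<in> borel_measurable M"
        using measurable_compose[OF \<pi>' borel_measurable_continuous_on_restrict[OF \<phi>]] .
      show "\<psi> \<in> borel_measurable M" using borel_measurable_continuous_onI[OF \<psi>(1)] by simp
      show "AE t in M. \<phi> (\<pi>' t) = \<psi> t"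
        using AE_K by eventually_elim (simp add: \<psi>(2) \<pi>'_def)
    qed
    finally show "(\<lambda>i. (\<Sum>k<N (r i). \<phi> (x (r i) k)) / N (r i)) \<longlonglongrightarrow> integral\<^sup>L \<mu> \<phi>"
      using lim[OF \<psi>(1,3)] x by (simp add: \<psi>(2) c)
  qed (rule r)
qed

subsection \<open>Invariant measures and visits to null sets\<close>

lemma measurable_restrict_borel:
  fixes \<phi> :: "'b::metric_space \<Rightarrow> 'c::topological_space"
  assumes "sets \<mu> = sets (restrict_space borel \<Xi>)" "continuous_on \<Xi> \<phi>"
  shows "\<phi> \<in> borel_measurable \<mu>"
  using borel_measurable_continuous_on_restrict[OF assms(2)] measurable_cong_sets[OF assms(1) refl] by blast

lemma closed_in_sets:
  assumes "sets \<mu> = sets (restrict_space borel \<Xi>)" "closed A"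
  shows "A \<inter> \<Xi> \<in> sets \<mu>"
  using assms by (auto simp: sets_restrict_space Int_commute)

text \<open>The tents decrease to the indicator of the closed set, and dominated convergence
  applies. For empty \<open>A\<close>, \<open>infdist\<close> is 0 by convention and every tent
  would be 1.\<close>

lemma tent_integral_tendsto:
  fixes \<Xi> :: "'b::metric_space set"
  assumes \<mu>: "prob_space \<mu>" "space \<mu> = \<Xi>" "sets \<mu> = sets (restrict_space borel \<Xi>)"
    and A: "closed A" "A \<noteq> {}"
  shows "(\<lambda>j. \<integral>\<xi>. max 0 (1 - real j * infdist \<xi> A) \<partial>\<mu>) \<longlonglongrightarrow> measure \<mu> (A \<inter> \<Xi>)"
proof -
  interpret prob_space \<mu> by (rule \<mu>)
  have meas: "A \<inter> \<Xi> \<in> sets \<mu>" using closed_in_sets[OF \<mu>(3) A(1)] .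
  have "(\<lambda>j. \<integral>\<xi>. max 0 (1 - real j * infdist \<xi> A) \<partial>\<mu>) \<longlonglongrightarrow> (\<integral>\<xi>. indicator (A \<inter> \<Xi>) \<xi> \<partial>\<mu>)"
  proof (rule integral_dominated_convergence[where w="\<lambda>_. 1"])
    show "indicator (A \<inter> \<Xi>) \<in> borel_measurable \<mu>" using meas by simp
    show "(\<lambda>\<xi>. max 0 (1 - real j * infdist \<xi> A)) \<in> borel_measurable \<mu>" for j
      by (intro measurable_restrict_borel[OF \<mu>(3)] continuous_intros)
    show "AE \<xi> in \<mu>. norm (max 0 (1 - real j * infdist \<xi> A)) \<le> 1" for j
      using infdist_nonneg[of _ A] by (intro AE_I2) simp
    show "AE \<xi> in \<mu>. (\<lambda>j. max 0 (1 - real j * infdist \<xi> A)) \<longlonglongrightarrow> indicator (A \<inter> \<Xi>) \<xi>"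
    proof (rule AE_I2)
      fix \<xi> assume "\<xi> \<in> space \<mu>"
      then have "\<xi> \<in> \<Xi>" using \<mu>(2) by simp
      show "(\<lambda>j. max 0 (1 - real j * infdist \<xi> A)) \<longlonglongrightarrow> indicator (A \<inter> \<Xi>) \<xi>"
      proof (cases "\<xi> \<in> A")
        case True
        then show ?thesis using \<open>\<xi> \<in> \<Xi>\<close> by simp
      next
        case False
        then have d: "infdist \<xi> A > 0"
          using A in_closed_iff_infdist_zero[OF A] infdist_nonneg[of \<xi> A] by (simp add: less_le)
        have "\<forall>\<^sub>F j in sequentially. max 0 (1 - real j * infdist \<xi> A) = 0"
          using eventually_ge_at_top[of "nat \<lceil>1 / infdist \<xi> A\<rceil>"]
        proof eventually_elim
          case (elim j)
          then have "1 / infdist \<xi> A \<le> real j" by linarith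
          then have "1 \<le> real j * infdist \<xi> A" using d by (simp add: field_simps)
          then show ?case by simp
        qed
        then show ?thesis using False by (simp add: tendsto_eventually)
      qed
    qed
  qed simp
  then show ?thesis using meas by simp
qed

text \<open>The traces of closed sets on \<Xi> are an intersection-stable generator, and their
  measures are limits of integrals of continuous tents.\<close>

lemma prob_measure_eqI_continuous:
  fixes \<Xi> :: "'b::metric_space set"
  assumes \<mu>: "prob_space \<mu>" "space \<mu> = \<Xi>" "sets \<mu> = sets (restrict_space borel \<Xi>)"
    and \<nu>: "prob_space \<nu>" "space \<nu> = \<Xi>" "sets \<nu> = sets (restrict_space borel \<Xi>)"
    and "closed \<Xi>"
    and eq: "\<And>\<phi> :: 'b \<Rightarrow> real. continuous_on \<Xi> \<phi> \<Longrightarrow> integral\<^sup>L \<mu> \<phi> = integral\<^sup>L \<nu> \<phi>"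
  shows "\<mu> = \<nu>"
proof -
  interpret \<mu>: prob_space \<mu> by (rule \<mu>)
  interpret \<nu>: prob_space \<nu> by (rule \<nu>)
  define E where "E = (\<inter>) \<Xi> ` Collect closed"
  have "sets (borel :: 'b measure) = sigma_sets UNIV (Collect closed)"
    unfolding borel_eq_closed by simp
  then have sets: "sets (restrict_space borel \<Xi>) = sigma_sets \<Xi> E"
    unfolding sets_restrict_space E_def
    using sigma_sets_Int[of \<Xi> UNIV "Collect closed"] \<open>closed \<Xi>\<close> by (auto intro: sigma_sets.Basic)
  show ?thesis
  proof (rule measure_eqI_generator_eq[where E=E and \<Omega>=\<Xi> and A="\<lambda>_. \<Xi>"])
    show "Int_stable E"
      unfolding Int_stable_def E_def
    proof safe
      fix a b :: "'b set" assume "closed a" "closed b"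
      then show "\<Xi> \<inter> a \<inter> (\<Xi> \<inter> b) \<in> (\<inter>) \<Xi> ` Collect closed"
        by (intro image_eqI[of _ _ "a \<inter> b"]) auto
    qed
    fix D assume "D \<in> E"
    then obtain A where A: "closed A" "D = A \<inter> \<Xi>" by (auto simp: E_def)
    show "emeasure \<mu> D = emeasure \<nu> D"
    proof (cases "A = {}")
      case False
      have "(\<integral>\<xi>. max 0 (1 - real j * infdist \<xi> A) \<partial>\<mu>) = (\<integral>\<xi>. max 0 (1 - real j * infdist \<xi> A) \<partial>\<nu>)" for j
        by (intro eq continuous_intros)
      then have "measure \<mu> D = measure \<nu> D"
        using tent_integral_tendsto[OF \<mu> A(1) False] tendsto_unique[OF _ _ tent_integral_tendsto[OF \<nu> A(1) False]]
        by (simp add: A(2))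
      then show ?thesis by (simp add: \<mu>.emeasure_eq_measure \<nu>.emeasure_eq_measure)
    qed (simp add: A)
  qed (auto simp: E_def \<mu>(3) \<nu>(3) sets[unfolded E_def] intro!: image_eqI[of _ _ UNIV])
qed

text \<open>The averages of \<open>\<phi> \<circ> g\<close> and \<phi> differ by a telescoping sum
  divided by the length, which tends to 0 because \<open>N n > n\<close>. The starting points may
  vary with \<open>n\<close>, as needed for visit bounds uniform in the starting point.\<close>

lemma Krylov_Bogoliubov:
  fixes \<Xi> :: "'b::metric_space set" and \<xi> :: "nat \<Rightarrow> 'b" and N :: "nat \<Rightarrow> nat"
  assumes \<Xi>: "compact \<Xi>" and g: "continuous_self_map \<Xi> g" and \<xi>: "\<And>n. \<xi> n \<in> \<Xi>"
    and N: "\<And>n. N n > n"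
  obtains r \<mu> where "strict_mono (r :: nat \<Rightarrow> nat)" "invariant_prob_measure \<Xi> g \<mu>"
    "\<And>\<phi> :: 'b \<Rightarrow> real. continuous_on \<Xi> \<phi> \<Longrightarrow>
       (\<lambda>i. (\<Sum>k<N (r i). \<phi> ((g ^^ k) (\<xi> (r i)))) / N (r i)) \<longlonglongrightarrow> integral\<^sup>L \<mu> \<phi>"
proof -
  have N': "N n > 0" for n using N[of n] by simp
  have orb: "(g ^^ k) (\<xi> n) \<in> \<Xi>" for n k using g \<xi> by (rule funpow_in)
  obtain r \<mu> where r: "strict_mono (r :: nat \<Rightarrow> nat)"
    and \<mu>: "prob_space \<mu>" "space \<mu> = \<Xi>" "sets \<mu> = sets (restrict_space borel \<Xi>)"
    and lim: "\<And>\<phi> :: 'b \<Rightarrow> real. continuous_on \<Xi> \<phi> \<Longrightarrow>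
       (\<lambda>i. (\<Sum>k<N (r i). \<phi> ((g ^^ k) (\<xi> (r i)))) / N (r i)) \<longlonglongrightarrow> integral\<^sup>L \<mu> \<phi>"
    by (rule compact_empirical_measures_converge[OF \<Xi>, of "\<lambda>n k. (g ^^ k) (\<xi> n)" N]) (use orb N' in blast)+
  interpret prob_space \<mu> by (rule \<mu>)
  have gc: "continuous_on \<Xi> g" "g \<in> \<Xi> \<rightarrow> \<Xi>" using g by (auto simp: continuous_self_map_def)
  have "g \<in> \<mu> \<rightarrow>\<^sub>M restrict_space borel \<Xi>"
    using gc(2) \<mu>(2) by (intro measurable_restrict_space2 measurable_restrict_borel[OF \<mu>(3) gc(1)]) auto
  then have g_meas: "g \<in> \<mu> \<rightarrow>\<^sub>M \<mu>"
    using measurable_cong_sets[OF refl \<mu>(3)] by blast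
  have "distr \<mu> \<mu> g = \<mu>"
  proof (rule prob_measure_eqI_continuous[OF _ _ _ \<mu>])
    show "prob_space (distr \<mu> \<mu> g)" using g_meas by (rule prob_space_distr)
    show "closed \<Xi>" using \<Xi> by (rule compact_imp_closed)
    fix \<phi> :: "'b \<Rightarrow> real" assume \<phi>: "continuous_on \<Xi> \<phi>"
    have \<phi>g: "continuous_on \<Xi> (\<lambda>\<zeta>. \<phi> (g \<zeta>))"
      using gc by (intro continuous_on_compose2[OF \<phi>]) auto
    obtain B where B: "B > 0" "\<And>\<zeta>. \<zeta> \<in> \<Xi> \<Longrightarrow> \<bar>\<phi> \<zeta>\<bar> \<le> B"
      using compact_imp_bounded[OF compact_continuous_image[OF \<phi> \<Xi>]] by (auto simp: bounded_pos)
    have "(\<lambda>i. (\<Sum>k<N (r i). \<phi> (g ((g ^^ k) (\<xi> (r i))))) / N (r i)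
             - (\<Sum>k<N (r i). \<phi> ((g ^^ k) (\<xi> (r i)))) / N (r i)) \<longlonglongrightarrow> 0"
    proof (rule Lim_null_comparison)
      show "(\<lambda>i. 2 * B / real (N (r i))) \<longlonglongrightarrow> 0"
      proof (rule tendsto_divide_0[OF tendsto_const])
        have "i \<le> N (r i)" for i using N[of "r i"] seq_suble[OF r, of i] by linarith
        then have "filterlim (\<lambda>i. N (r i)) at_top sequentially"
          by (intro filterlim_at_top_mono[OF filterlim_ident]) auto
        then show "filterlim (\<lambda>i. real (N (r i))) at_infinity sequentially"
          by (intro filterlim_at_top_imp_at_infinity filterlim_compose[OF filterlim_real_sequentially])
      qed
      show "\<forall>\<^sub>F i in sequentially. norm ((\<Sum>k<N (r i). \<phi> (g ((g ^^ k) (\<xi> (r i))))) / N (r i)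
             - (\<Sum>k<N (r i). \<phi> ((g ^^ k) (\<xi> (r i)))) / N (r i)) \<le> 2 * B / real (N (r i))"
      proof (intro always_eventually allI)
        fix i
        have "(\<Sum>k<N (r i). \<phi> (g ((g ^^ k) (\<xi> (r i))))) - (\<Sum>k<N (r i). \<phi> ((g ^^ k) (\<xi> (r i))))
            = \<phi> ((g ^^ N (r i)) (\<xi> (r i))) - \<phi> (\<xi> (r i))"
          using sum_lessThan_telescope[of "\<lambda>k. \<phi> ((g ^^ k) (\<xi> (r i)))" "N (r i)"]
          by (simp add: sum_subtractf)
        moreover have "\<bar>\<phi> ((g ^^ N (r i)) (\<xi> (r i))) - \<phi> (\<xi> (r i))\<bar> \<le> 2 * B"
          using B(2)[OF orb[of "N (r i)" "r i"]] B(2)[OF \<xi>[of "r i"]] by linarith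
        ultimately show "norm ((\<Sum>k<N (r i). \<phi> (g ((g ^^ k) (\<xi> (r i))))) / N (r i)
             - (\<Sum>k<N (r i). \<phi> ((g ^^ k) (\<xi> (r i)))) / N (r i)) \<le> 2 * B / real (N (r i))"
          by (simp add: abs_divide divide_right_mono flip: diff_divide_distrib)
      qed
    qed
    moreover have "(\<lambda>i. (\<Sum>k<N (r i). \<phi> (g ((g ^^ k) (\<xi> (r i))))) / N (r i)
             - (\<Sum>k<N (r i). \<phi> ((g ^^ k) (\<xi> (r i)))) / N (r i))
          \<longlonglongrightarrow> (\<integral>\<zeta>. \<phi> (g \<zeta>) \<partial>\<mu>) - integral\<^sup>L \<mu> \<phi>"
      by (intro tendsto_diff lim \<phi> \<phi>g)
    ultimately have "(\<integral>\<zeta>. \<phi> (g \<zeta>) \<partial>\<mu>) - integral\<^sup>L \<mu> \<phi> = 0"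
      using LIMSEQ_unique by blast
    then show "integral\<^sup>L (distr \<mu> \<mu> g) \<phi> = integral\<^sup>L \<mu> \<phi>"
      by (simp add: integral_distr[OF g_meas measurable_restrict_borel[OF \<mu>(3) \<phi>]])
  qed (simp_all add: \<mu>)
  then have "invariant_prob_measure \<Xi> g \<mu>"
    using \<mu> by (simp add: invariant_prob_measure_def)
  then show ?thesis using that r lim by blast
qed

lemma universally_null_rarely_visited:
  fixes \<Xi> :: "'b::metric_space set" and \<epsilon> :: real
  assumes \<Xi>: "compact \<Xi>" and g: "continuous_self_map \<Xi> g" and C: "closed C" "C \<noteq> {}"
    and null: "\<And>\<mu>. invariant_prob_measure \<Xi> g \<mu> \<Longrightarrow> measure \<mu> (C \<inter> \<Xi>) = 0"
    and "\<epsilon> > 0"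
  obtains U and n0 :: nat where "open U" "C \<subseteq> U"
    "\<And>\<xi> n. \<lbrakk>\<xi> \<in> \<Xi>; n \<ge> n0\<rbrakk> \<Longrightarrow> card {k. k < n \<and> (g ^^ k) \<xi> \<in> U} \<le> \<epsilon> * n"
proof -
  \<comment> \<open>On \<open>U j\<close> the tent of slope \<open>j\<close> exceeds 1/2, which
    turns counted visits into lower bounds for integrals. The sets decrease in
    \<open>j\<close>.\<close>
  define U where "U j = {\<xi>. real j * infdist \<xi> C < 1/2}" for j
  have U: "open (U j)" "C \<subseteq> U j" for j
    unfolding U_def by (auto intro!: open_Collect_less continuous_intros)
  define rare where "rare j \<xi> n \<longleftrightarrow> card {k. k < n \<and> (g ^^ k) \<xi> \<in> U j} \<le> \<epsilon> * n" for j \<xi> n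
  \<comment> \<open>One index bounds both the neighbourhood and the length, so the negation yields
    ever longer orbit segments that visit ever smaller neighbourhoods too often.\<close>
  have "\<exists>j. \<forall>\<xi>\<in>\<Xi>. \<forall>n>j. rare j \<xi> n"
  proof (rule ccontr)
    assume "\<not> ?thesis"
    then have "\<forall>j. \<exists>\<xi> n. \<xi> \<in> \<Xi> \<and> n > j \<and> \<not> rare j \<xi> n" by blast
    then obtain \<xi> N where \<xi>: "\<And>j. \<xi> j \<in> \<Xi>" and N: "\<And>j. N j > j"
      and not_rare: "\<And>j. \<not> rare j (\<xi> j) (N j)" by metis
    have many: "\<epsilon> * N j < card {k. k < N j \<and> (g ^^ k) (\<xi> j) \<in> U j}" for j
      using not_rare[of j] by (simp add: rare_def)
    obtain r \<mu> where r: "strict_mono (r :: nat \<Rightarrow> nat)" and \<mu>: "invariant_prob_measure \<Xi> g \<mu>"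
      and lim: "\<And>\<phi> :: 'b \<Rightarrow> real. continuous_on \<Xi> \<phi> \<Longrightarrow>
        (\<lambda>i. (\<Sum>k<N (r i). \<phi> ((g ^^ k) (\<xi> (r i)))) / N (r i)) \<longlonglongrightarrow> integral\<^sup>L \<mu> \<phi>"
      by (rule Krylov_Bogoliubov[where N=N and \<xi>=\<xi>, OF \<Xi> g]) (use \<xi> N in blast)+
    \<comment> \<open>The tent is kept fixed while the segments vary: for
      \<open>r i \<ge> j\<close>, visits to \<open>U (r i)\<close> are visits to \<open>U j\<close>.
      Only afterwards does \<open>j\<close> tend to infinity.\<close>
    have ge: "(\<integral>\<zeta>. max 0 (1 - real j * infdist \<zeta> C) \<partial>\<mu>) \<ge> \<epsilon>/2" for j
    proof (rule tendsto_lowerbound[OF lim])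
      show "continuous_on \<Xi> (\<lambda>\<zeta>. max 0 (1 - real j * infdist \<zeta> C))" by (intro continuous_intros)
      show "\<forall>\<^sub>F i in sequentially. \<epsilon>/2 \<le>
        (\<Sum>k<N (r i). max 0 (1 - real j * infdist ((g ^^ k) (\<xi> (r i))) C)) / N (r i)"
        using eventually_ge_at_top[of j]
      proof eventually_elim
        case (elim i)
        then have "j \<le> r i" using seq_suble[OF r, of i] by linarith
        define V where "V = {k. k < N (r i) \<and> (g ^^ k) (\<xi> (r i)) \<in> U (r i)}"
        have half: "max 0 (1 - real j * infdist \<zeta> C) \<ge> 1/2" if "\<zeta> \<in> U (r i)" for \<zeta>
        proof -
          have "real j * infdist \<zeta> C \<le> real (r i) * infdist \<zeta> C"
            using \<open>j \<le> r i\<close> by (intro mult_right_mono infdist_nonneg) simp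
          then show ?thesis using that by (auto simp: U_def)
        qed
        have "\<epsilon>/2 * N (r i) \<le> (\<Sum>k\<in>V. 1/2)"
          using many[of "r i"] by (simp add: V_def)
        also have "\<dots> \<le> (\<Sum>k\<in>V. max 0 (1 - real j * infdist ((g ^^ k) (\<xi> (r i))) C))"
          by (intro sum_mono half) (simp add: V_def)
        also have "\<dots> \<le> (\<Sum>k<N (r i). max 0 (1 - real j * infdist ((g ^^ k) (\<xi> (r i))) C))"
          by (intro sum_mono2) (auto simp: V_def)
        finally show ?case using N[of "r i"] by (simp add: pos_le_divide_eq)
      qed
    qed simp
    have "prob_space \<mu>" "space \<mu> = \<Xi>" "sets \<mu> = sets (restrict_space borel \<Xi>)"
      using \<mu> by (auto simp: invariant_prob_measure_def)
    from tendsto_lowerbound[OF tent_integral_tendsto[OF this C] always_eventually[OF allI[OF ge]]]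
    have "measure \<mu> (C \<inter> \<Xi>) \<ge> \<epsilon>/2" by simp
    then show False using null[OF \<mu>] \<open>\<epsilon> > 0\<close> by simp
  qed
  then obtain j where "\<And>\<xi> n. \<lbrakk>\<xi> \<in> \<Xi>; n > j\<rbrakk> \<Longrightarrow> rare j \<xi> n"
    by blast
  then show ?thesis using U[of j] by (intro that[of "U j" "Suc j"]) (auto simp: rare_def)
qed

section \<open>Finite separation numbers of almost sure 1-1 extensions\<close>

lemma ecard_gt_1:
  assumes "x \<in> A" "y \<in> A" "x \<noteq> y"
  shows "ecard A > 1"
proof (cases "finite A")
  case True
  then have "card {x, y} \<le> card A" using assms by (intro card_mono) auto
  then show ?thesis using True assms(3) by (simp add: ecard_def one_enat_def)
qed (simp add: ecard_def one_enat_def)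

lemma almost_sure_1_1_extension_finite_Sep:
  fixes X :: "'a::metric_space set" and \<Xi> :: "'b::metric_space set"
  assumes X: "compact X" and eq: "equicontinuous_system \<Xi> g" and fac: "factor_map X f \<Xi> g h"
    and null: "\<And>\<mu>. invariant_prob_measure \<Xi> g \<mu> \<Longrightarrow> {\<xi>\<in>\<Xi>. ecard {x\<in>X. h x = \<xi>} > 1} \<in> null_sets \<mu>"
    and "\<delta> > 0" "\<nu> > 0"
  shows "Sep X f \<delta> \<nu> < \<infinity>"
proof -
  have g: "continuous_self_map \<Xi> g" and h: "continuous_on X h" "h ` X = \<Xi>"
    using fac by (auto simp: factor_map_def)
  have h_in: "h x \<in> \<Xi>" if "x \<in> X" for x using h(2) that by auto
  have \<Xi>: "compact \<Xi>" using compact_continuous_image[OF h(1) X] h(2) by simp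
  \<comment> \<open>Pairs witnessing a large fibre form a compact set, so its image \<open>C\<close>
    is compact and, in particular, measurable.\<close>
  define P where "P = {p \<in> X \<times> X. dist (fst p) (snd p) \<ge> \<delta> \<and> h (fst p) = h (snd p)}"
  define C where "C = (\<lambda>p. h (fst p)) ` P"
  have XX: "compact (X \<times> X)" using X X by (rule compact_Times)
  then have cXX: "closed (X \<times> X)" by (rule compact_imp_closed)
  have hf: "continuous_on (X \<times> X) (\<lambda>p. h (fst p))" "continuous_on (X \<times> X) (\<lambda>p. h (snd p))"
    by (auto intro!: continuous_on_compose2[OF h(1)] continuous_on_fst continuous_on_snd continuous_on_id)
  have cd: "continuous_on (X \<times> X) (\<lambda>p. dist (fst p) (snd p))"
    by (intro continuous_intros)
  have "closed (X \<times> X \<inter> (\<lambda>p. dist (fst p) (snd p)) -` {\<delta>..})"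
    by (intro continuous_closed_preimage cd cXX) auto
  moreover have "closed (X \<times> X \<inter> (\<lambda>p. dist (h (fst p)) (h (snd p))) -` {0})"
    by (intro continuous_closed_preimage continuous_on_dist hf cXX) auto
  moreover have "P = (X \<times> X) \<inter> ((X \<times> X \<inter> (\<lambda>p. dist (fst p) (snd p)) -` {\<delta>..})
      \<inter> (X \<times> X \<inter> (\<lambda>p. dist (h (fst p)) (h (snd p))) -` {0}))"
    by (auto simp: P_def)
  ultimately have "compact P" by (simp only: compact_Int_closed[OF XX] closed_Int)
  then have "compact C"
    unfolding C_def by (intro compact_continuous_image continuous_on_subset[OF hf(1)]) (auto simp: P_def)
  then have "closed C" by (rule compact_imp_closed)
  have in_C: "h x \<in> C" if "x \<in> X" "y \<in> X" "h x = h y" "dist x y \<ge> \<delta>" for x y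
    unfolding C_def by (rule image_eqI[of _ _ "(x, y)"]) (use that in \<open>auto simp: P_def\<close>)
  have C_sub: "C \<subseteq> {\<xi>\<in>\<Xi>. ecard {x\<in>X. h x = \<xi>} > 1}"
  proof
    fix \<xi> assume "\<xi> \<in> C"
    then obtain x y where xy: "x \<in> X" "y \<in> X" "h x = \<xi>" "h y = \<xi>" "dist x y \<ge> \<delta>"
      by (auto simp: C_def P_def)
    then have "x \<noteq> y" using \<open>\<delta> > 0\<close> by auto
    then have "ecard {x\<in>X. h x = \<xi>} > 1" using xy by (intro ecard_gt_1[of x _ y]) auto
    then show "\<xi> \<in> {\<xi>\<in>\<Xi>. ecard {x\<in>X. h x = \<xi>} > 1}" using xy h_in by auto
  qed
  have C_null: "measure \<mu> (C \<inter> \<Xi>) = 0" if \<mu>: "invariant_prob_measure \<Xi> g \<mu>" for \<mu>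
  proof -
    have "C \<inter> \<Xi> \<in> sets \<mu>"
      using \<mu> \<open>closed C\<close> by (intro closed_in_sets) (auto simp: invariant_prob_measure_def)
    then have "C \<inter> \<Xi> \<in> null_sets \<mu>"
      using null_sets_subset[OF null[OF \<mu>]] C_sub by blast
    then show ?thesis by (simp add: null_sets_def measure_def)
  qed
  \<comment> \<open>Visits of frequency at most \<nu>/2 keep the limsup strictly below
    \<nu>.\<close>
  have "\<nu>/2 > 0" using \<open>\<nu> > 0\<close> by simp
  obtain U and n0 :: nat where U: "open U" "C \<subseteq> U"
    and rare: "\<And>\<xi> n. \<lbrakk>\<xi> \<in> \<Xi>; n \<ge> n0\<rbrakk> \<Longrightarrow> card {k. k < n \<and> (g ^^ k) \<xi> \<in> U} \<le> \<nu>/2 * n"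
  proof (cases "C = {}")
    case True
    then show ?thesis using \<open>\<nu> > 0\<close> by (intro that[of "{}" 0]) auto
  next
    case False
    show ?thesis
      by (rule universally_null_rarely_visited[OF \<Xi> g \<open>closed C\<close> False _ \<open>\<nu>/2 > 0\<close>])
        (use C_null that in blast)+
  qed
  obtain \<eta> where \<eta>: "\<eta> > 0"
    "\<And>x y. \<lbrakk>x \<in> X; y \<in> X; h x \<notin> U; dist (h x) (h y) < \<eta>\<rbrakk> \<Longrightarrow> dist x y < \<delta>"
    by (rule close_images_imp_close[OF X h(1) U(1), of \<delta>]) (use in_C U(2) in blast)+
  obtain F :: "'b set" and c where F: "finite F" "c \<in> \<Xi> \<rightarrow> F"
    and cl: "\<And>\<xi> \<zeta> n. \<lbrakk>\<xi> \<in> \<Xi>; \<zeta> \<in> \<Xi>; c \<xi> = c \<zeta>\<rbrakk> \<Longrightarrow> dist ((g ^^ n) \<xi>) ((g ^^ n) \<zeta>) < \<eta>"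
    using equicontinuous_system_finite_classes[OF eq \<Xi> \<eta>(1)] by blast
  have not_sep: "\<not> separated_points f \<delta> \<nu> x y" if xy: "x \<in> X" "y \<in> X" "c (h x) = c (h y)" for x y
  proof -
    have f: "continuous_self_map X f" using fac by (simp add: factor_map_def)
    have sub: "{k. k < n \<and> dist ((f ^^ k) x) ((f ^^ k) y) \<ge> \<delta>} \<subseteq> {k. k < n \<and> (g ^^ k) (h x) \<in> U}" for n
    proof safe
      fix k assume "dist ((f ^^ k) x) ((f ^^ k) y) \<ge> \<delta>"
      moreover have "dist (h ((f ^^ k) x)) (h ((f ^^ k) y)) < \<eta>"
        using cl[of "h x" "h y" k] xy h_in by (simp add: factor_map_funpow[OF fac])
      ultimately have "h ((f ^^ k) x) \<in> U"
        using \<eta>(2)[of "(f ^^ k) x" "(f ^^ k) y"] funpow_in[OF f] xy by force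
      then show "(g ^^ k) (h x) \<in> U" using xy(1) by (simp add: factor_map_funpow[OF fac])
    qed
    have "limsup (\<lambda>n. ereal (real (sep_count f \<delta> x y n) / real n)) \<le> ereal (\<nu>/2)"
    proof (rule Limsup_bounded)
      show "\<forall>\<^sub>F n in sequentially. ereal (real (sep_count f \<delta> x y n) / real n) \<le> ereal (\<nu>/2)"
        using eventually_ge_at_top[of "Suc n0"]
      proof eventually_elim
        case (elim n)
        have "sep_count f \<delta> x y n \<le> card {k. k < n \<and> (g ^^ k) (h x) \<in> U}"
          unfolding sep_count_def using sub by (intro card_mono) auto
        also have "real \<dots> \<le> \<nu>/2 * n" using rare[of "h x" n] elim h_in xy(1) by simp
        finally have "real (sep_count f \<delta> x y n) \<le> \<nu>/2 * real n" by simp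
        then show ?case using elim by (simp add: pos_divide_le_eq)
      qed
    qed
    also have "ereal (\<nu>/2) < ereal \<nu>" using \<open>\<nu> > 0\<close> by simp
    finally show ?thesis by (simp add: separated_points_def)
  qed
  have "ecard S \<le> enat (card F)" if S: "S \<subseteq> X" "separated_set f \<delta> \<nu> S" for S
  proof -
    \<comment> \<open>Points of one class are never separated, so a separated set has at most one
      point per class.\<close>
    have "inj_on (\<lambda>x. c (h x)) S"
      using S not_sep unfolding separated_set_def by (intro inj_onI) blast
    moreover have "(\<lambda>x. c (h x)) ` S \<subseteq> F" using S(1) F(2) h_in by auto
    ultimately have "finite S" "card S \<le> card F"
      using F(1) by (auto intro: inj_on_finite card_inj_on_le)
    then show ?thesis by (simp add: ecard_def)
  qed
  then have "Sep X f \<delta> \<nu> \<le> enat (card F)"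
    unfolding Sep_def by (intro SUP_least) auto
  then show ?thesis using le_less_trans by fastforce
qed

theorem theorem1p2:
  fixes X :: "'a::metric_space set" and f :: "'a \<Rightarrow> 'a"
  assumes "compact X" and "\<exists>f'. homeomorphism X X f f'"
  shows "(minimal_system X f \<and> almost_automorphic TYPE('b::metric_space) X f \<and>
            \<not> equicontinuous_system X f
          \<longrightarrow> unbounded_separation_numbers X f) \<and>
         ((\<exists>(\<Xi> :: 'c::metric_space set) g.
             equicontinuous_system \<Xi> g \<and> almost_sure_1_1_extension X f \<Xi> g)
          \<longrightarrow> finite_separation_numbers X f)"
proof (intro conjI impI)
  have surj: "f ` X = X" using assms(2) by (auto simp: homeomorphism_def)
  assume "minimal_system X f \<and> almost_automorphic TYPE('b) X f \<and> \<not> equicontinuous_system X f"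
  then show "unbounded_separation_numbers X f"
    using almost_automorphic_unbounded[OF assms(1) surj] by blast
next
  assume "\<exists>(\<Xi> :: 'c set) g. equicontinuous_system \<Xi> g \<and> almost_sure_1_1_extension X f \<Xi> g"
  then obtain \<Xi> :: "'c set" and g where eq: "equicontinuous_system \<Xi> g"
    and ext: "almost_sure_1_1_extension X f \<Xi> g" by blast
  from ext obtain h where fac: "factor_map X f \<Xi> g h"
    and null: "\<And>\<mu>. invariant_prob_measure \<Xi> g \<mu> \<Longrightarrow>
      {\<xi>\<in>\<Xi>. ecard {x\<in>X. h x = \<xi>} > 1} \<in> null_sets \<mu>"
    unfolding almost_sure_1_1_extension_def by auto
  show "finite_separation_numbers X f"
    unfolding finite_separation_numbers_def
    using almost_sure_1_1_extension_finite_Sep[OF assms(1) eq fac null] by simp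
qed

end
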